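(* There exists $\epsilon>0$ such that for every positive integer $n$, every 2-increasing sequence of triples with all coordinates in $[n]=\{1,\dots,n\}$ has length at most $n^{2-\epsilon}$.
   Context: For integer triples $a=(a_1,a_2,a_3)$ and $b=(b_1,b_2,b_3)$, write $a<_2b$ ("$a$ is 2-less than $b$") if $a_i<b_i$ for at least two indices $i\in\{1,2,3\}$. A sequence $a^1,\dots,a^m$ of triples is 2-increasing if $a^i<_2a^j$ whenever $i<j$. *)

theory Defs
  imports Complex_Main "HOL-Analysis.Finite_Cartesian_Product"
begin

definition two_less :: "int ^ 3 \<Rightarrow> int ^ 3 \<Rightarrow> bool" where
  "two_less a b \<longleftrightarrow> card {i. a $ i < b $ i} \<ge> 2"

definition two_increasing :: "(int ^ 3) list \<Rightarrow> bool" where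
  "two_increasing as \<longleftrightarrow>
     (\<forall>i j. i < j \<and> j < length as \<longrightarrow> two_less (as ! i) (as ! j))"

end

theory Submission
  imports Defs "HOL-Analysis.Cartesian_Space"
begin

text \<open>
  Only pairwise comparability is used: two triples of the sequence that agree in one coordinate are
  strictly ordered, in the same direction, by the other two. Let \<open>X, Y, Z\<close> be the coordinates of a
  uniformly random element of such a set \<open>S\<close>. If \<open>S\<close> has a partition \<open>T\<close> with
  \<open>H(T|X) + H(T|Y) + H(T|Z) < (3/2 - c) H(T)\<close>, then the bound
  \<open>H(X) + H(Y) + H(Z) \<ge> (3/2 + c) (ln |S| - ln M)\<close> passes from the parts of \<open>T\<close> to \<open>S\<close>, so by
  induction it suffices to find such a partition for every large \<open>S\<close>; since the left-hand side is
  at most \<open>3 ln n\<close>, the bound gives \<open>|S| \<le> M n\<^bsup>2 - \<epsilon>\<^esup>\<close>, and the constant \<open>M\<close> is absorbed by using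
  \<open>|S| < n\<^sup>2\<close> for small \<open>n\<close>.

  Suppose there is no such partition. Let \<open>A\<^sub>i, B\<^sub>i, C\<^sub>i\<close> be the dyadic quantile blocks of
  \<open>X, Y, Z\<close> at scale \<open>2\<^bsup>-i\<^esup>\<close>. For fixed \<open>Z\<close> the pair \<open>(A\<^sub>i, B\<^sub>i)\<close> runs along a monotone path, so
  \<open>H(A\<^sub>i, B\<^sub>i | Z) \<le> (i + 1) ln 2\<close>; testing the assumption on \<open>T = (A\<^sub>i, B\<^sub>i)\<close> and
  \<open>T = (A\<^sub>i, B\<^sub>i, C\<^sub>i)\<close> shows that \<open>B\<^sub>i\<close> has almost full entropy given \<open>X\<close> (and likewise for the
  other pairs) and that \<open>C\<^sub>i\<close> has bounded entropy given \<open>(A\<^sub>i, B\<^sub>i)\<close>. By the pigeonhole principle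
  there is a range of scales on which the fine blocks are almost independent of the exact values of
  the other coordinates and on which, given a coarse block of \<open>Z\<close>, a finer block \<open>C\<close> is almost a
  function \<open>F(A, B)\<close>. The almost-independence makes \<open>F\<close> increasing in both arguments, whereas a
  fixed \<open>Z\<close> is attained along an increasing chain of cells \<open>(A, B)\<close>. So \<open>F\<close> is constant between
  two cells of such a chain, and \<open>C\<close> is determined by \<open>Y\<close> and a block of \<open>X\<close> that is too coarse
  for the entropy of \<open>C\<close> given \<open>Y\<close>.
\<close>

section \<open>Entropy of functions on a finite set\<close>

definition fib :: "'s set \<Rightarrow> ('s \<Rightarrow> 'a) \<Rightarrow> 's \<Rightarrow> 's set" where
  "fib S f s = {t \<in> S. f t = f s}"

text \<open>Shannon entropy, in nats, of \<open>f\<close> at a uniformly random point of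
  \<open>S\<close>, written as an average over points instead of a sum over values.\<close>

definition ent :: "'s set \<Rightarrow> ('s \<Rightarrow> 'a) \<Rightarrow> real" where
  "ent S f = (\<Sum>s\<in>S. ln (real (card S) / real (card (fib S f s)))) / real (card S)"

abbreviation joint :: "('s \<Rightarrow> 'a) \<Rightarrow> ('s \<Rightarrow> 'b) \<Rightarrow> 's \<Rightarrow> 'a \<times> 'b"  (infixr "\<otimes>" 70) where
  "f \<otimes> g \<equiv> (\<lambda>s. (f s, g s))"

text \<open>Conditional entropy, defined through the chain rule.\<close>

definition cent :: "'s set \<Rightarrow> ('s \<Rightarrow> 'a) \<Rightarrow> ('s \<Rightarrow> 'b) \<Rightarrow> real" where
  "cent S f g = ent S (f \<otimes> g) - ent S g"

definition determines :: "'s set \<Rightarrow> ('s \<Rightarrow> 'a) \<Rightarrow> ('s \<Rightarrow> 'b) \<Rightarrow> bool" where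
  "determines S g f \<longleftrightarrow> (\<forall>s\<in>S. \<forall>t\<in>S. g s = g t \<longrightarrow> f s = f t)"

text \<open>Conditional expectation of \<open>\<phi>\<close> given \<open>f\<close>.\<close>

definition avg :: "'s set \<Rightarrow> ('s \<Rightarrow> 'a) \<Rightarrow> ('s \<Rightarrow> real) \<Rightarrow> 's \<Rightarrow> real" where
  "avg S f \<phi> s = (\<Sum>t\<in>fib S f s. \<phi> t) / real (card (fib S f s))"

lemma fib_subset: "fib S f s \<subseteq> S"
  by (auto simp: fib_def)

lemma finite_fib [simp]: "finite S \<Longrightarrow> finite (fib S f s)"
  by (auto simp: fib_def)

lemma card_fib_pos: "finite S \<Longrightarrow> s \<in> S \<Longrightarrow> card (fib S f s) > 0"
  by (auto simp: fib_def card_gt_0_iff)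

lemma fib_cong: "f s = f t \<Longrightarrow> fib S f s = fib S f t"
  by (simp add: fib_def)

text \<open>The tower property: after exchanging the sums, each \<open>t\<close> is counted once for
  every point of its own fibre, with weight one over the size of that fibre.\<close>

lemma sum_avg:
  assumes "finite S"
  shows "(\<Sum>s\<in>S. avg S f \<phi> s) = (\<Sum>s\<in>S. \<phi> s)"
proof -
  have "(\<Sum>s\<in>S. avg S f \<phi> s) = (\<Sum>s\<in>S. \<Sum>t\<in>S. if f t = f s then \<phi> t / real (card (fib S f s)) else 0)"
  proof (intro sum.cong refl)
    fix s
    show "avg S f \<phi> s = (\<Sum>t\<in>S. if f t = f s then \<phi> t / real (card (fib S f s)) else 0)"
      using assms unfolding avg_def sum_divide_distrib
      by (subst sum.inter_filter[symmetric]) (auto simp: fib_def)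
  qed
  also have "\<dots> = (\<Sum>t\<in>S. \<Sum>s\<in>S. if f t = f s then \<phi> t / real (card (fib S f s)) else 0)"
    by (rule sum.swap)
  also have "\<dots> = (\<Sum>t\<in>S. \<phi> t)"
  proof (intro sum.cong refl)
    fix t assume t: "t \<in> S"
    have "(\<Sum>s\<in>S. if f t = f s then \<phi> t / real (card (fib S f s)) else 0)
        = (\<Sum>s\<in>S. if f s = f t then \<phi> t / real (card (fib S f t)) else 0)"
      by (intro sum.cong refl) (auto simp: fib_def)
    also have "\<dots> = (\<Sum>s\<in>fib S f t. \<phi> t / real (card (fib S f t)))"
      using assms unfolding fib_def by (subst sum.inter_filter) auto
    also have "\<dots> = \<phi> t"
      using card_fib_pos[OF assms t, of f] by simp
    finally show "(\<Sum>s\<in>S. if f t = f s then \<phi> t / real (card (fib S f s)) else 0) = \<phi> t" .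
  qed
  finally show ?thesis .
qed

lemma fiber_markov:
  assumes "finite S" "\<theta> > 0" and nn: "\<And>s. s \<in> S \<Longrightarrow> \<phi> s \<ge> 0"
  shows "\<theta> * real (card {s \<in> S. avg S f \<phi> s > \<theta>}) \<le> (\<Sum>s\<in>S. \<phi> s)"
proof -
  have "\<theta> * real (card {s \<in> S. avg S f \<phi> s > \<theta>}) = (\<Sum>s\<in>{s \<in> S. avg S f \<phi> s > \<theta>}. \<theta>)"
    by simp
  also have "\<dots> \<le> (\<Sum>s\<in>{s \<in> S. avg S f \<phi> s > \<theta>}. avg S f \<phi> s)"
    by (intro sum_mono) auto
  also have "\<dots> \<le> (\<Sum>s\<in>S. avg S f \<phi> s)"
    using assms by (intro sum_mono2) (auto simp: avg_def fib_def intro!: divide_nonneg_nonneg sum_nonneg)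
  finally show ?thesis using sum_avg[OF assms(1), of f \<phi>] by simp
qed

lemma cent_eq:
  assumes "finite S"
  shows "cent S f g = (\<Sum>s\<in>S. ln (real (card (fib S g s)) / real (card (fib S (f \<otimes> g) s)))) / real (card S)"
proof -
  have "(\<Sum>s\<in>S. ln (real (card S) / real (card (fib S (f \<otimes> g) s)))) -
        (\<Sum>s\<in>S. ln (real (card S) / real (card (fib S g s))))
      = (\<Sum>s\<in>S. ln (real (card (fib S g s)) / real (card (fib S (f \<otimes> g) s))))"
    unfolding sum_subtractf[symmetric]
  proof (intro sum.cong refl)
    fix s assume s: "s \<in> S"
    have "card S > 0" using assms s by (auto simp: card_gt_0_iff)
    then show "ln (real (card S) / real (card (fib S (f \<otimes> g) s))) - ln (real (card S) / real (card (fib S g s)))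
       = ln (real (card (fib S g s)) / real (card (fib S (f \<otimes> g) s)))"
      using card_fib_pos[OF assms s, of g] card_fib_pos[OF assms s, of "f \<otimes> g"]
      by (simp add: ln_div)
  qed
  then show ?thesis
    by (simp add: cent_def ent_def diff_divide_distrib[symmetric])
qed

text \<open>Gibbs' inequality: \<open>r\<close> guesses the conditional probability of the value of
  \<open>f\<close> given \<open>g\<close>, and the last hypothesis says that on each fibre of
  \<open>g\<close> the guesses, averaged over points with equal value, add up to at most 1. The
  proof is \<open>ln x \<le> x - 1\<close>; several bounds below are special choices of
  \<open>r\<close>.\<close>

lemma gibbs:
  assumes fin: "finite S" and pos: "\<And>s. s \<in> S \<Longrightarrow> r s > 0"
    and le: "\<And>s. s \<in> S \<Longrightarrow> (\<Sum>t\<in>fib S g s. r t / real (card (fib S (f \<otimes> g) t))) \<le> 1"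
  shows "cent S f g \<le> (\<Sum>s\<in>S. - ln (r s)) / real (card S)"
proof -
  let ?c = "\<lambda>s. real (card (fib S g s))" and ?d = "\<lambda>s. real (card (fib S (f \<otimes> g) s))"
  have "(\<Sum>s\<in>S. ln (?c s / ?d s) + ln (r s)) \<le> (\<Sum>s\<in>S. ?c s * (r s / ?d s) - 1)"
  proof (intro sum_mono)
    fix s assume s: "s \<in> S"
    have p: "?c s > 0" "?d s > 0" "r s > 0"
      using card_fib_pos[OF fin s] pos[OF s] by auto
    have "ln (?c s / ?d s) + ln (r s) = ln (?c s * (r s / ?d s))"
      using p by (simp add: ln_mult ln_div)
    also have "\<dots> \<le> ?c s * (r s / ?d s) - 1"
      using p by (intro ln_le_minus_one) auto
    finally show "ln (?c s / ?d s) + ln (r s) \<le> ?c s * (r s / ?d s) - 1" .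
  qed
  also have "\<dots> = (\<Sum>s\<in>S. avg S g (\<lambda>t. ?c t * (r t / ?d t)) s - 1)"
    using sum_avg[OF fin, of g "\<lambda>t. ?c t * (r t / ?d t)"] by (simp add: sum_subtractf)
  also have "\<dots> \<le> (\<Sum>s\<in>S. 0)"
  proof (intro sum_mono)
    fix s assume s: "s \<in> S"
    have cp: "?c s > 0" using card_fib_pos[OF fin s] by auto
    have "(\<Sum>t\<in>fib S g s. ?c t * (r t / ?d t)) = ?c s * (\<Sum>t\<in>fib S g s. r t / ?d t)"
      unfolding sum_distrib_left by (intro sum.cong refl) (auto simp: fib_def)
    then have "avg S g (\<lambda>t. ?c t * (r t / ?d t)) s = (\<Sum>t\<in>fib S g s. r t / ?d t)"
      using cp unfolding avg_def by simp
    with le[OF s] show "avg S g (\<lambda>t. ?c t * (r t / ?d t)) s - 1 \<le> 0" by simp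
  qed
  finally have "(\<Sum>s\<in>S. ln (?c s / ?d s)) \<le> (\<Sum>s\<in>S. - ln (r s))"
    by (simp add: sum.distrib sum_negf)
  then show ?thesis
    unfolding cent_eq[OF fin] by (intro divide_right_mono) auto
qed

text \<open>Turns the normalisation hypothesis of \<open>gibbs\<close> into a sum over values: the
  points with a given value share its weight equally.\<close>

lemma sum_over_values:
  assumes fin: "finite S" 
  shows "(\<Sum>t\<in>fib S g s. h (f t) / real (card (fib S (f \<otimes> g) t))) = (\<Sum>v\<in>f ` fib S g s. h v)"
proof -
  have "(\<Sum>t\<in>fib S g s. h (f t) / real (card (fib S (f \<otimes> g) t)))
     = (\<Sum>v\<in>f ` fib S g s. \<Sum>t\<in>{t \<in> fib S g s. f t = v}. h (f t) / real (card (fib S (f \<otimes> g) t)))"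
    using fin by (intro sum.image_gen) auto
  also have "\<dots> = (\<Sum>v\<in>f ` fib S g s. h v)"
  proof (intro sum.cong refl)
    fix v assume "v \<in> f ` fib S g s"
    then obtain t0 where t0: "t0 \<in> fib S g s" "v = f t0" by auto
    have eq: "{t \<in> fib S g s. f t = v} = fib S (f \<otimes> g) t0"
      using t0 by (auto simp: fib_def)
    have "(\<Sum>t\<in>{t \<in> fib S g s. f t = v}. h (f t) / real (card (fib S (f \<otimes> g) t)))
       = (\<Sum>t\<in>fib S (f \<otimes> g) t0. h v / real (card (fib S (f \<otimes> g) t0)))"
      unfolding eq
    proof (intro sum.cong refl)
      fix t assume "t \<in> fib S (f \<otimes> g) t0"
      then have e: "(f \<otimes> g) t = (f \<otimes> g) t0" by (auto simp: fib_def)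
      with t0 show "h (f t) / real (card (fib S (f \<otimes> g) t)) = h v / real (card (fib S (f \<otimes> g) t0))"
        using fib_cong[of "f \<otimes> g" t t0 S, OF e] by simp
    qed
    also have "\<dots> = h v"
      using card_fib_pos[OF fin, of t0 "f \<otimes> g"] t0 by (auto simp: fib_def)
    finally show "(\<Sum>t\<in>{t \<in> fib S g s. f t = v}. h (f t) / real (card (fib S (f \<otimes> g) t))) = h v" .
  qed
  finally show ?thesis .
qed

lemma ent_mono:
  assumes fin: "finite S" and det: "determines S g f"
  shows "ent S f \<le> ent S g"
  unfolding ent_def
proof (intro divide_right_mono sum_mono)
  fix s assume s: "s \<in> S"
  have "fib S g s \<subseteq> fib S f s"
    using det s unfolding fib_def determines_def by blast
  then have "card (fib S g s) \<le> card (fib S f s)"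
    using fin by (intro card_mono) auto
  then show "ln (real (card S) / real (card (fib S f s))) \<le> ln (real (card S) / real (card (fib S g s)))"
    using card_fib_pos[OF fin s, of g] card_fib_pos[OF fin s, of f] card_gt_0_iff[of S] fin s
    by (intro ln_mono divide_left_mono divide_pos_pos) auto
qed auto

lemma ent_cong:
  assumes "finite S" "determines S g f" "determines S f g"
  shows "ent S f = ent S g"
  using ent_mono assms by (metis order_antisym)

lemma cent_cong:
  assumes "finite S" "determines S (f \<otimes> g) (f' \<otimes> g')" "determines S (f' \<otimes> g') (f \<otimes> g)"
     "determines S g g'" "determines S g' g"
  shows "cent S f g = cent S f' g'"
  using ent_cong[OF assms(1,3,2)] ent_cong[OF assms(1,5,4)] by (simp add: cent_def)

lemma cent_nonneg: "finite S \<Longrightarrow> cent S f g \<ge> 0"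
  unfolding cent_def using ent_mono[of S "f \<otimes> g" g] by (auto simp: determines_def)

lemma ent_const: "finite S \<Longrightarrow> ent S (\<lambda>_. c) = 0"
  by (cases "S = {}") (auto simp: ent_def fib_def)

lemma ent_eq_cent: "finite S \<Longrightarrow> ent S f = cent S f (\<lambda>_. ())"
  unfolding cent_def using ent_cong[of S "f \<otimes> (\<lambda>_. ())" f]
  by (auto simp: determines_def ent_const)

lemma ent_nonneg: "finite S \<Longrightarrow> ent S f \<ge> 0"
  by (simp add: ent_eq_cent cent_nonneg)

text \<open>\<open>gibbs\<close> with the true conditional probabilities given \<open>h\<close>
  alone as guesses; they sum to 1 over a fibre of \<open>h\<close>, hence to at most 1 over any
  smaller fibre.\<close>

lemma cent_antimono:
  assumes fin: "finite S"
  shows "cent S f (g \<otimes> h) \<le> cent S f h"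
proof -
  let ?r = "\<lambda>s. real (card (fib S (f \<otimes> h) s)) / real (card (fib S h s))"
  have "cent S f (g \<otimes> h) \<le> (\<Sum>s\<in>S. - ln (?r s)) / real (card S)"
  proof (rule gibbs[OF fin])
    fix s assume s: "s \<in> S"
    show "?r s > 0"
      using card_fib_pos[OF fin s, of h] card_fib_pos[OF fin s, of "f \<otimes> h"] by simp
    let ?q = "\<lambda>v. real (card {u \<in> fib S h s. f u = v}) / real (card (fib S h s))"
    have "(\<Sum>t\<in>fib S (g \<otimes> h) s. ?r t / real (card (fib S (f \<otimes> (g \<otimes> h)) t)))
       = (\<Sum>t\<in>fib S (g \<otimes> h) s. ?q (f t) / real (card (fib S (f \<otimes> (g \<otimes> h)) t)))"
    proof (intro sum.cong refl)
      fix t assume "t \<in> fib S (g \<otimes> h) s"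
      then have "h t = h s" by (auto simp: fib_def)
      then have "fib S (f \<otimes> h) t = {u \<in> fib S h s. f u = f t}" "fib S h t = fib S h s"
        by (auto simp: fib_def)
      then show "?r t / real (card (fib S (f \<otimes> (g \<otimes> h)) t)) = ?q (f t) / real (card (fib S (f \<otimes> (g \<otimes> h)) t))"
        by simp
    qed
    also have "\<dots> = (\<Sum>v\<in>f ` fib S (g \<otimes> h) s. ?q v)"
      by (rule sum_over_values[OF fin])
    also have "\<dots> \<le> (\<Sum>v\<in>f ` fib S h s. ?q v)"
      using fin by (intro sum_mono2) (auto simp: fib_def)
    also have "\<dots> = real (\<Sum>v\<in>f ` fib S h s. card {u \<in> fib S h s. f u = v}) / real (card (fib S h s))"
      by (simp add: sum_divide_distrib)
    also have "(\<Sum>v\<in>f ` fib S h s. card {u \<in> fib S h s. f u = v}) = card (fib S h s)"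
      using sum.image_gen[of "fib S h s" "\<lambda>_. 1::nat" f] fin by simp
    also have "real (card (fib S h s)) / real (card (fib S h s)) \<le> 1" by simp
    finally show "(\<Sum>t\<in>fib S (g \<otimes> h) s. ?r t / real (card (fib S (f \<otimes> (g \<otimes> h)) t))) \<le> 1" .
  qed
  also have "(\<Sum>s\<in>S. - ln (?r s)) = (\<Sum>s\<in>S. ln (real (card (fib S h s)) / real (card (fib S (f \<otimes> h) s))))"
  proof (intro sum.cong refl)
    fix s assume s: "s \<in> S"
    show "- ln (?r s) = ln (real (card (fib S h s)) / real (card (fib S (f \<otimes> h) s)))"
      using card_fib_pos[OF fin s, of h] card_fib_pos[OF fin s, of "f \<otimes> h"] by (simp add: ln_div)
  qed
  finally show ?thesis by (simp add: cent_eq[OF fin])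
qed

lemma cent_antimono_det:
  assumes fin: "finite S" and "determines S g h"
  shows "cent S f g \<le> cent S f h"
proof -
  have "cent S f g = cent S f (g \<otimes> h)"
    using assms(2) by (intro cent_cong[OF fin]) (unfold determines_def, blast+)
  then show ?thesis using cent_antimono[OF fin] by simp
qed

lemma cent_mono_det:
  assumes fin: "finite S" and "determines S (f' \<otimes> g) f"
  shows "cent S f g \<le> cent S f' g"
proof -
  have "determines S (f' \<otimes> g) (f \<otimes> g)"
    using assms(2) unfolding determines_def by blast
  then show ?thesis
    unfolding cent_def using ent_mono[OF fin, of "f' \<otimes> g" "f \<otimes> g"] by simp
qed

lemma cent_le_ent: "finite S \<Longrightarrow> cent S f g \<le> ent S f"
  using cent_antimono_det[of S g "\<lambda>_. ()" f] by (simp add: ent_eq_cent determines_def)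

text \<open>Encode each value with one bit saying whether it lies in the exceptional set \<open>K\<close>.\<close>
lemma cent_le_exceptional:
  assumes fin: "finite S" and ne: "S \<noteq> {}" and m: "m > 0" and n: "n > 0"
    and K: "\<And>s. s \<in> S \<Longrightarrow> finite (K (g s)) \<and> card (K (g s)) \<le> m"
    and rng: "\<And>s. s \<in> S \<Longrightarrow> card (f ` fib S g s) \<le> n"
  shows "cent S f g \<le> ln 2 + real (card {s \<in> S. f s \<in> K (g s)}) / real (card S) * ln (real m)
      + (1 - real (card {s \<in> S. f s \<in> K (g s)}) / real (card S)) * ln (real n)"
proof -
  let ?r = "\<lambda>s. if f s \<in> K (g s) then 1 / (2 * real m) else 1 / (2 * real n)"
  have "cent S f g \<le> (\<Sum>s\<in>S. - ln (?r s)) / real (card S)"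
  proof (rule gibbs[OF fin])
    fix s assume s: "s \<in> S"
    show "?r s > 0" using m n by auto
    let ?h = "\<lambda>v. if v \<in> K (g s) then 1 / (2 * real m) else 1 / (2 * real n)"
    have "(\<Sum>t\<in>fib S g s. ?r t / real (card (fib S (f \<otimes> g) t)))
       = (\<Sum>t\<in>fib S g s. ?h (f t) / real (card (fib S (f \<otimes> g) t)))"
      by (intro sum.cong refl) (auto simp: fib_def)
    also have "\<dots> = (\<Sum>v\<in>f ` fib S g s. ?h v)"
      by (rule sum_over_values[OF fin])
    also have "\<dots> = (\<Sum>v\<in>f ` fib S g s \<inter> K (g s). 1 / (2 * real m)) + (\<Sum>v\<in>f ` fib S g s - K (g s). 1 / (2 * real n))"
      using fin by (subst sum.If_cases) (auto simp: Diff_eq)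
    also have "\<dots> = real (card (f ` fib S g s \<inter> K (g s))) / (2 * real m) + real (card (f ` fib S g s - K (g s))) / (2 * real n)"
      by simp
    also have "\<dots> \<le> real m / (2 * real m) + real n / (2 * real n)"
    proof (intro add_mono divide_right_mono)
      have "card (f ` fib S g s \<inter> K (g s)) \<le> card (K (g s))"
        using K[OF s] by (intro card_mono) auto
      then show "real (card (f ` fib S g s \<inter> K (g s))) \<le> real m" using K[OF s] by simp
      have "card (f ` fib S g s - K (g s)) \<le> card (f ` fib S g s)"
        using fin by (intro card_mono) auto
      then show "real (card (f ` fib S g s - K (g s))) \<le> real n" using rng[OF s] by simp
    qed auto
    also have "\<dots> = 1" using m n by simp
    finally show "(\<Sum>t\<in>fib S g s. ?r t / real (card (fib S (f \<otimes> g) t))) \<le> 1" .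
  qed
  also have "(\<Sum>s\<in>S. - ln (?r s)) = (\<Sum>s\<in>S. if f s \<in> K (g s) then ln 2 + ln (real m) else ln 2 + ln (real n))"
    using m n by (intro sum.cong) (auto simp: ln_div ln_mult)
  also have "\<dots> = real (card {s \<in> S. f s \<in> K (g s)}) * (ln 2 + ln (real m)) + real (card {s \<in> S. \<not> f s \<in> K (g s)}) * (ln 2 + ln (real n))"
    using fin by (simp add: sum.If_cases Int_def Collect_neg_eq[symmetric])
  also have "real (card {s \<in> S. \<not> f s \<in> K (g s)}) = real (card S) - real (card {s \<in> S. f s \<in> K (g s)})"
  proof -
    have "S = {s \<in> S. f s \<in> K (g s)} \<union> {s \<in> S. \<not> f s \<in> K (g s)}" by auto
    then have "card S = card {s \<in> S. f s \<in> K (g s)} + card {s \<in> S. \<not> f s \<in> K (g s)}"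
      using fin card_Un_disjoint[of "{s \<in> S. f s \<in> K (g s)}" "{s \<in> S. \<not> f s \<in> K (g s)}"] by auto
    then show ?thesis by simp
  qed
  finally have *: "cent S f g \<le> (real (card {s \<in> S. f s \<in> K (g s)}) * (ln 2 + ln (real m)) +
      (real (card S) - real (card {s \<in> S. f s \<in> K (g s)})) * (ln 2 + ln (real n))) / real (card S)" .
  have N: "real (card S) > 0" using fin ne by (simp add: card_gt_0_iff)
  have "(k * (c + a) + (N - k) * (c + b)) / N = c + k / N * a + (1 - k / N) * b" if "N > 0" for k a b c N :: real
    using that by (simp add: field_simps)
  with * N show ?thesis by simp
qed

text \<open>The uniform guess \<open>1 / n\<close> in \<open>gibbs\<close>.\<close>

lemma cent_le_ln_card:
  assumes fin: "finite S" and ne: "S \<noteq> {}" 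
    and rng: "\<And>s. s \<in> S \<Longrightarrow> card (f ` fib S g s) \<le> n"
  shows "cent S f g \<le> ln (real n)"
proof -
  from ne obtain s0 where s0: "s0 \<in> S" by auto
  have n: "n > 0"
    using rng[OF s0] fin s0 card_gt_0_iff[of "f ` fib S g s0"] by (auto simp: fib_def)
  have "cent S f g \<le> (\<Sum>s\<in>S. - ln (1 / real n)) / real (card S)"
  proof (rule gibbs[OF fin])
    fix s assume s: "s \<in> S"
    have "(\<Sum>t\<in>fib S g s. 1 / real n / real (card (fib S (f \<otimes> g) t))) = (\<Sum>v\<in>f ` fib S g s. 1 / real n)"
      using sum_over_values[OF fin, of "\<lambda>_. 1 / real n" f g s] by simp
    also have "\<dots> \<le> 1" using rng[OF s] n by (simp add: field_simps)
    finally show "(\<Sum>t\<in>fib S g s. 1 / real n / real (card (fib S (f \<otimes> g) t))) \<le> 1" .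
  qed (use n in auto)
  also have "\<dots> = ln (real n)" using n fin ne by (simp add: ln_div)
  finally show ?thesis .
qed

lemma ent_le_ln_card:
  assumes "finite S" "S \<noteq> {}" "card (f ` S) \<le> n"
  shows "ent S f \<le> ln (real n)"
  unfolding ent_eq_cent[OF assms(1)] using assms
  by (intro cent_le_ln_card) (auto simp: fib_def)

lemma ent_ge_small_fibers:
  assumes "finite S" "S \<noteq> {}" and "\<And>s. s \<in> S \<Longrightarrow> real (card (fib S f s)) \<le> q * real (card S)"
  shows "ent S f \<ge> - ln q"
proof -
  have N: "real (card S) > 0" using assms by (simp add: card_gt_0_iff)
  from assms(2) obtain s0 where s0: "s0 \<in> S" by auto
  have "0 < real (card (fib S f s0))" using card_fib_pos[OF assms(1) s0, of f] by simp
  then have "0 < q * real (card S)" using assms(3)[OF s0] by linarith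
  then have q: "q > 0" using N by (simp add: zero_less_mult_iff)
  have "(\<Sum>s\<in>S. - ln q) \<le> (\<Sum>s\<in>S. ln (real (card S) / real (card (fib S f s))))"
  proof (intro sum_mono)
    fix s assume s: "s \<in> S"
    have p: "real (card (fib S f s)) > 0" using card_fib_pos[OF assms(1) s, of f] by simp
    have "- ln q = ln (1 / q)" using q by (simp add: ln_div)
    also have "\<dots> \<le> ln (real (card S) / real (card (fib S f s)))"
      using assms(3)[OF s] p q N by (intro ln_mono) (auto simp: field_simps)
    finally show "- ln q \<le> ln (real (card S) / real (card (fib S f s)))" .
  qed
  then show ?thesis using N by (simp add: ent_def field_simps)
qed

section \<open>Conditional probabilities\<close>

definition cp :: "'s set \<Rightarrow> ('s \<Rightarrow> 'a) \<Rightarrow> 's \<Rightarrow> ('s \<Rightarrow> bool) \<Rightarrow> real" where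
  "cp S f s P = real (card {t \<in> fib S f s. P t}) / real (card (fib S f s))"

lemma cp_eq_avg: "finite S \<Longrightarrow> cp S f s P = avg S f (\<lambda>t. if P t then 1 else 0) s"
  unfolding cp_def avg_def by (subst sum.inter_filter[symmetric]) auto

lemma cp_cong: "f s = f t \<Longrightarrow> cp S f s P = cp S f t P"
  by (simp add: cp_def fib_def)

lemma cp_mono:
  assumes "finite S" "\<And>t. t \<in> S \<Longrightarrow> f t = f s \<Longrightarrow> P t \<Longrightarrow> Q t"
  shows "cp S f s P \<le> cp S f s Q"
proof -
  have "card {t \<in> fib S f s. P t} \<le> card {t \<in> fib S f s. Q t}"
    using assms by (intro card_mono) (auto simp: fib_def)
  then show ?thesis by (simp add: cp_def divide_right_mono)
qed

lemma cp_disj: 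
  assumes "finite S" 
  shows "cp S f s (\<lambda>t. P t \<or> Q t) \<le> cp S f s P + cp S f s Q"
proof -
  have "{t \<in> fib S f s. P t \<or> Q t} = {t \<in> fib S f s. P t} \<union> {t \<in> fib S f s. Q t}" by auto
  then have "card {t \<in> fib S f s. P t \<or> Q t} \<le> card {t \<in> fib S f s. P t} + card {t \<in> fib S f s. Q t}"
    by (simp add: card_Un_le)
  then have "real (card {t \<in> fib S f s. P t \<or> Q t}) \<le> real (card {t \<in> fib S f s. P t}) + real (card {t \<in> fib S f s. Q t})"
    by linarith
  then show ?thesis unfolding cp_def add_divide_distrib[symmetric] by (rule divide_right_mono) simp
qed

lemma cp_True: "finite S \<Longrightarrow> s \<in> S \<Longrightarrow> cp S f s (\<lambda>_. True) = 1"
  by (auto simp: cp_def fib_def)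

lemma cp_compl:
  assumes "finite S" "s \<in> S"
  shows "cp S f s (\<lambda>t. \<not> P t) = 1 - cp S f s P"
proof -
  have "fib S f s = {t \<in> fib S f s. P t} \<union> {t \<in> fib S f s. \<not> P t}" by auto
  then have "card (fib S f s) = card {t \<in> fib S f s. P t} + card {t \<in> fib S f s. \<not> P t}"
    using assms card_Un_disjoint[of "{t \<in> fib S f s. P t}" "{t \<in> fib S f s. \<not> P t}"] by auto
  then have "real (card {t \<in> fib S f s. \<not> P t}) = real (card (fib S f s)) - real (card {t \<in> fib S f s. P t})"
    by simp
  then show ?thesis using card_fib_pos[OF assms, of f] by (simp add: cp_def diff_divide_distrib del: of_nat_add)
qed

lemma cp_pos_ex:
  assumes "cp S f s P > 0"
  obtains t where "t \<in> S" "f t = f s" "P t"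
proof -
  have "card {t \<in> fib S f s. P t} \<noteq> 0"
    using assms unfolding cp_def by (intro notI) simp
  then have "{t \<in> fib S f s. P t} \<noteq> {}" by (metis card.empty)
  then show ?thesis using that by (auto simp: fib_def)
qed

lemma cp_both_ex:
  assumes "finite S" "s \<in> S" "cp S f s P + cp S f s Q > 1"
  obtains t where "t \<in> S" "f t = f s" "P t" "Q t"
proof -
  have "1 - cp S f s (\<lambda>t. P t \<and> Q t) = cp S f s (\<lambda>t. \<not> P t \<or> \<not> Q t)"
    using cp_compl[OF assms(1,2), of f "\<lambda>t. P t \<and> Q t"] by simp
  also have "\<dots> \<le> cp S f s (\<lambda>t. \<not> P t) + cp S f s (\<lambda>t. \<not> Q t)"
    by (rule cp_disj[OF assms(1)])
  also have "\<dots> = 2 - cp S f s P - cp S f s Q"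
    using cp_compl[OF assms(1,2), of f P] cp_compl[OF assms(1,2), of f Q] by simp
  finally have "cp S f s (\<lambda>t. P t \<and> Q t) > 0" using assms(3) by simp
  then show ?thesis using cp_pos_ex[of S f s "\<lambda>t. P t \<and> Q t"] that by auto
qed

lemma cp_markov:
  assumes "finite S" "\<theta> > 0"
  shows "\<theta> * real (card {s \<in> S. cp S f s P > \<theta>}) \<le> real (card {s \<in> S. P s})"
proof -
  have "(\<Sum>s\<in>S. if P s then 1 else 0) = real (card {s \<in> S. P s})"
    using assms by (subst sum.inter_filter[symmetric]) auto
  with fiber_markov[of S \<theta> "\<lambda>t. if P t then 1 else 0" f] assms show ?thesis
    by (simp add: cp_eq_avg)
qed

section \<open>Near independence from small conditional mutual information\<close>

lemma square_le_minus_ln: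
  fixes x :: real
  assumes "0 < x" "x \<le> 1"
  shows "(1 - x)\<^sup>2 / 2 \<le> x - 1 - ln x"
proof -
  let ?f = "\<lambda>x::real. x - 1 - ln x - (1 - x)\<^sup>2 / 2"
  have "?f 1 \<le> ?f x"
  proof (rule DERIV_nonpos_imp_nonincreasing[OF assms(2)])
    fix y assume y: "x \<le> y" "y \<le> 1"
    have y0: "y > 0" using y assms by simp
    have "DERIV ?f y :> 1 - 1 / y + (1 - y)"
      using y0 by (auto intro!: derivative_eq_intros simp: field_simps)
    moreover have "1 - 1 / y + (1 - y) = - ((1 - y)\<^sup>2 / y)"
      using y0 by (simp add: field_simps power2_eq_square)
    ultimately show "\<exists>d. DERIV ?f y :> d \<and> d \<le> 0"
      using y0 by (intro exI[of _ "1 - 1 / y + (1 - y)"]) auto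
  qed
  then show ?thesis by simp
qed

text \<open>Total variation distance at most \<open>\<theta>\<close> between the laws of
  \<open>v\<close> given \<open>(u, w)\<close> and given \<open>w\<close>. The one-sided bound
  suffices because \<open>K\<close> may be complemented, as in \<open>close_lower\<close>.\<close>

definition close :: "'s set \<Rightarrow> ('s \<Rightarrow> 'a) \<Rightarrow> ('s \<Rightarrow> 'b) \<Rightarrow> ('s \<Rightarrow> 'c) \<Rightarrow> real \<Rightarrow> 's \<Rightarrow> bool" where
  "close S v u w \<theta> s \<longleftrightarrow>
     (\<forall>K. cp S (u \<otimes> w) s (\<lambda>t. v t \<in> K) \<le> cp S w s (\<lambda>t. v t \<in> K) + \<theta>)"

text \<open>Pinsker's inequality followed by Markov's; \<open>\<rho>\<close> is the likelihood ratio.\<close>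
lemma close_markov:
  assumes fin: "finite S" and ne: "S \<noteq> {}" and pos: "\<theta> > 0" "\<delta> > 0"
    and info: "cent S v w - cent S v (u \<otimes> w) \<le> \<delta>\<^sup>2 / 2"
  shows "\<theta> * real (card {s \<in> S. \<not> close S v u w \<theta> s}) \<le> \<delta> * real (card S)"
proof -
  define N where "N = real (card S)"
  have N: "N > 0" using fin ne by (simp add: N_def card_gt_0_iff)
  let ?uw = "\<lambda>s. real (card (fib S (u \<otimes> w) s))" and ?vw = "\<lambda>s. real (card (fib S (v \<otimes> w) s))"
    and ?w = "\<lambda>s. real (card (fib S w s))" and ?vuw = "\<lambda>s. real (card (fib S (v \<otimes> (u \<otimes> w)) s))"
  define \<rho> where "\<rho> s = ?uw s * ?vw s / (?w s * ?vuw s)" for s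
  \<comment> \<open>The average of \<open>\<phi>\<close> over a fibre of
    \<open>u \<otimes> w\<close> is the total variation distance that \<open>close\<close> has to
    bound.\<close>
  define \<phi> where "\<phi> s = max 0 (1 - \<rho> s)" for s
  have cpos: "?uw s > 0" "?vw s > 0" "?w s > 0" "?vuw s > 0" if "s \<in> S" for s
    using card_fib_pos[OF fin that] by auto
  have \<rho>pos: "\<rho> s > 0" if "s \<in> S" for s using cpos[OF that] by (simp add: \<rho>_def)
  \<comment> \<open>Weighting by \<open>\<rho>\<close> replaces probabilities given
    \<open>(u, w)\<close> by those given \<open>w\<close>; values of \<open>v\<close> that do not
    occur on the smaller fibre are lost, hence an inequality.\<close>
  have tail: "(\<Sum>t\<in>fib S (u \<otimes> w) s. if v t \<in> K then \<rho> t else 0) / ?uw s \<le> cp S w s (\<lambda>t. v t \<in> K)"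
    if s: "s \<in> S" for s K
  proof -
    let ?h = "\<lambda>x. if x \<in> K then real (card {t \<in> fib S w s. v t = x}) / ?w s else 0"
    have "(\<Sum>t\<in>fib S (u \<otimes> w) s. if v t \<in> K then \<rho> t else 0) / ?uw s
        = (\<Sum>t\<in>fib S (u \<otimes> w) s. ?h (v t) / ?vuw t)"
      unfolding sum_divide_distrib
    proof (intro sum.cong refl)
      fix t assume t: "t \<in> fib S (u \<otimes> w) s"
      then have tS: "t \<in> S" and e: "(u \<otimes> w) t = (u \<otimes> w) s" "w t = w s" by (auto simp: fib_def)
      have "?uw t = ?uw s" "?w t = ?w s" "fib S (v \<otimes> w) t = {r \<in> fib S w s. v r = v t}"
        using fib_cong[of "u \<otimes> w" t s S, OF e(1)] fib_cong[of w t s S, OF e(2)] e(2)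
        by (auto simp: fib_def)
      then show "(if v t \<in> K then \<rho> t else 0) / ?uw s = ?h (v t) / ?vuw t"
        using cpos[OF s] by (simp add: \<rho>_def)
    qed
    also have "\<dots> = (\<Sum>x\<in>v ` fib S (u \<otimes> w) s. ?h x)"
      by (rule sum_over_values[OF fin])
    also have "\<dots> \<le> (\<Sum>x\<in>v ` fib S w s. ?h x)"
      using fin by (intro sum_mono2) (auto simp: fib_def)
    also have "\<dots> = (\<Sum>x\<in>v ` fib S w s. real (card {t \<in> {t \<in> fib S w s. v t \<in> K}. v t = x})) / ?w s"
      unfolding sum_divide_distrib
    proof (intro sum.cong refl)
      fix x
      have "{t \<in> {t \<in> fib S w s. v t \<in> K}. v t = x} = (if x \<in> K then {t \<in> fib S w s. v t = x} else {})"
        by auto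
      then show "?h x = real (card {t \<in> {t \<in> fib S w s. v t \<in> K}. v t = x}) / ?w s" by simp
    qed
    also have "(\<Sum>x\<in>v ` fib S w s. real (card {t \<in> {t \<in> fib S w s. v t \<in> K}. v t = x}))
        = (\<Sum>x\<in>v ` {t \<in> fib S w s. v t \<in> K}. real (card {t \<in> {t \<in> fib S w s. v t \<in> K}. v t = x}))"
      using fin by (intro sum.mono_neutral_right) (auto simp: card_eq_0_iff)
    also have "\<dots> = real (card {t \<in> fib S w s. v t \<in> K})"
      using sum.image_gen[of "{t \<in> fib S w s. v t \<in> K}" "\<lambda>_. 1::real" v] fin by simp
    finally show ?thesis by (simp add: cp_def)
  qed
  have "(\<Sum>s\<in>S. \<rho> s) = (\<Sum>s\<in>S. avg S (u \<otimes> w) \<rho> s)"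
    by (rule sum_avg[OF fin, symmetric])
  also have "\<dots> \<le> (\<Sum>s\<in>S. 1)"
    using tail[where K = UNIV] fin by (intro sum_mono) (auto simp: avg_def cp_True)
  finally have sum\<rho>: "(\<Sum>s\<in>S. \<rho> s) \<le> N" by (simp add: N_def)
  have "cent S v w - cent S v (u \<otimes> w) = (\<Sum>s\<in>S. - ln (\<rho> s)) / N"
    unfolding cent_eq[OF fin] N_def diff_divide_distrib[symmetric] sum_subtractf[symmetric]
  proof (intro arg_cong2[where f = "(/)"] sum.cong refl)
    fix s assume s: "s \<in> S"
    show "ln (?w s / ?vw s) - ln (?uw s / ?vuw s) = - ln (\<rho> s)"
      using cpos[OF s] by (simp add: \<rho>_def ln_div ln_mult)
  qed
  with info N have sumln: "(\<Sum>s\<in>S. - ln (\<rho> s)) \<le> N * (\<delta>\<^sup>2 / 2)"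
    by (simp add: field_simps)
  \<comment> \<open>Expanding a square bounds \<open>\<phi>\<close> so that only sums of
    \<open>\<rho>\<close> and of \<open>ln \<rho>\<close> remain, which are controlled by
    \<open>sum\<rho>\<close> and \<open>sumln\<close>.\<close>
  have pt: "\<phi> s \<le> \<delta> / 2 + (\<rho> s - 1 - ln (\<rho> s)) / \<delta>" if s: "s \<in> S" for s
  proof -
    have "0 \<le> (\<phi> s - \<delta>)\<^sup>2" by simp
    then have "\<phi> s \<le> \<delta> / 2 + (\<phi> s)\<^sup>2 / 2 / \<delta>"
      using pos by (simp add: power2_diff field_simps power2_eq_square)
    also have "(\<phi> s)\<^sup>2 / 2 \<le> \<rho> s - 1 - ln (\<rho> s)"
    proof (cases "\<rho> s \<le> 1")
      case True
      then show ?thesis using square_le_minus_ln[OF \<rho>pos[OF s]] by (simp add: \<phi>_def max_def)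
    next
      case False
      then show ?thesis using ln_le_minus_one[OF \<rho>pos[OF s]] by (simp add: \<phi>_def max_def)
    qed
    finally show ?thesis using pos by (simp add: divide_right_mono)
  qed
  have "(\<Sum>s\<in>S. \<phi> s) \<le> (\<Sum>s\<in>S. \<delta> / 2 + (\<rho> s - 1 - ln (\<rho> s)) / \<delta>)"
    by (intro sum_mono pt)
  also have "\<dots> = N * (\<delta> / 2) + ((\<Sum>s\<in>S. \<rho> s) - N + (\<Sum>s\<in>S. - ln (\<rho> s))) / \<delta>"
    by (simp add: sum.distrib sum_subtractf sum_divide_distrib[symmetric] N_def sum_negf)
  also have "\<dots> \<le> N * (\<delta> / 2) + (N * (\<delta>\<^sup>2 / 2)) / \<delta>"
    using sum\<rho> sumln pos by (intro add_left_mono divide_right_mono) auto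
  also have "\<dots> = \<delta> * N" using pos by (simp add: power2_eq_square)
  finally have sum\<phi>: "(\<Sum>s\<in>S. \<phi> s) \<le> \<delta> * N" .
  have cl: "close S v u w \<theta> s" if s: "s \<in> S" and le: "avg S (u \<otimes> w) \<phi> s \<le> \<theta>" for s
    unfolding close_def
  proof
    fix K
    let ?F = "fib S (u \<otimes> w) s"
    have "cp S (u \<otimes> w) s (\<lambda>t. v t \<in> K) = (\<Sum>t\<in>?F. if v t \<in> K then 1 else 0) / ?uw s"
      using fin by (simp add: cp_eq_avg avg_def)
    also have "\<dots> \<le> (\<Sum>t\<in>?F. (if v t \<in> K then \<rho> t else 0) + \<phi> t) / ?uw s"
      by (intro divide_right_mono sum_mono) (auto simp: \<phi>_def)
    also have "\<dots> = (\<Sum>t\<in>?F. if v t \<in> K then \<rho> t else 0) / ?uw s + avg S (u \<otimes> w) \<phi> s"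
      by (simp add: sum.distrib add_divide_distrib avg_def)
    also have "\<dots> \<le> cp S w s (\<lambda>t. v t \<in> K) + \<theta>"
      using tail[OF s, of K] le by (intro add_mono) auto
    finally show "cp S (u \<otimes> w) s (\<lambda>t. v t \<in> K) \<le> cp S w s (\<lambda>t. v t \<in> K) + \<theta>" .
  qed
  have "card {s \<in> S. \<not> close S v u w \<theta> s} \<le> card {s \<in> S. avg S (u \<otimes> w) \<phi> s > \<theta>}"
    using fin cl by (intro card_mono) (auto simp: not_less[symmetric])
  then have "\<theta> * real (card {s \<in> S. \<not> close S v u w \<theta> s}) \<le> \<theta> * real (card {s \<in> S. avg S (u \<otimes> w) \<phi> s > \<theta>})"
    using pos by simp
  also have "\<dots> \<le> (\<Sum>s\<in>S. \<phi> s)"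
    by (rule fiber_markov[OF fin pos(1)]) (simp add: \<phi>_def)
  finally show ?thesis using sum\<phi> by (simp add: N_def)
qed

lemma close_lower:
  assumes "finite S" "s \<in> S" "close S v u w \<theta> s"
  shows "cp S w s (\<lambda>t. v t \<in> K) \<le> cp S (u \<otimes> w) s (\<lambda>t. v t \<in> K) + \<theta>"
proof -
  have "cp S (u \<otimes> w) s (\<lambda>t. v t \<in> - K) \<le> cp S w s (\<lambda>t. v t \<in> - K) + \<theta>"
    using assms(3) unfolding close_def by blast
  then show ?thesis
    using cp_compl[OF assms(1,2), of "u \<otimes> w" "\<lambda>t. v t \<in> K"] cp_compl[OF assms(1,2), of w "\<lambda>t. v t \<in> K"]
    by simp
qed

text \<open>\<open>F\<close> takes the most likely value of \<open>f\<close> on each fibre of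
  \<open>g\<close>. If that value has probability \<open>p\<close>, the error is
  \<open>1 - p \<le> - ln p\<close>, and \<open>- ln p\<close> is at most the entropy on the
  fibre.\<close>

lemma guess_of_small_cent:
  assumes fin: "finite S" 
  obtains F where "real (card {s \<in> S. f s \<noteq> F (g s)}) \<le> cent S f g * real (card S)"
proof -
  let ?c = "\<lambda>s. real (card (fib S g s))" and ?d = "\<lambda>s. real (card (fib S (f \<otimes> g) s))"
  have "\<exists>r. r \<in> fib S g s \<and> (\<forall>t\<in>fib S g s. ?d t \<le> ?d r)" if "s \<in> S" for s
  proof -
    have ne: "fib S g s \<noteq> {}" using that by (auto simp: fib_def)
    have "Max (?d ` fib S g s) \<in> ?d ` fib S g s" using ne fin by (intro Max_in) auto
    then obtain r where r: "r \<in> fib S g s" "?d r = Max (?d ` fib S g s)"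
      by (metis (no_types, lifting) image_iff)
    have "?d t \<le> ?d r" if "t \<in> fib S g s" for t
      unfolding r(2) using fin that by (intro Max_ge) auto
    with r(1) show ?thesis by blast
  qed
  then have "\<exists>R. \<forall>s\<in>S. R s \<in> fib S g s \<and> (\<forall>t\<in>fib S g s. ?d t \<le> ?d (R s))"
    by (intro bchoice) blast
  then obtain R where R: "\<And>s. s \<in> S \<Longrightarrow> R s \<in> fib S g s"
      "\<And>s t. s \<in> S \<Longrightarrow> t \<in> fib S g s \<Longrightarrow> ?d t \<le> ?d (R s)"
    by blast
  \<comment> \<open>A fixed representative of each fibre makes the guess depend on the value of
    \<open>g\<close> only.\<close>
  define F where "F y = f (R (SOME s. s \<in> S \<and> g s = y))" for y
  have "1 - cp S g s (\<lambda>t. f t = F (g t)) \<le> avg S g (\<lambda>t. ln (?c t / ?d t)) s" if s: "s \<in> S" for s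
  proof -
    define s' where "s' = (SOME t. t \<in> S \<and> g t = g s)"
    have s': "s' \<in> S" "g s' = g s" using someI[of "\<lambda>t. t \<in> S \<and> g t = g s" s] s by (auto simp: s'_def)
    have Fr: "F (g s) = f (R s')" by (simp add: F_def s'_def)
    have fibeq: "fib S g s' = fib S g s" using s' by (simp add: fib_def)
    have "R s' \<in> fib S g s" using R(1)[OF s'(1)] fibeq by simp
    then have "fib S (f \<otimes> g) (R s') = {t \<in> fib S g s. f t = F (g t)}"
      using Fr by (auto simp: fib_def)
    then have cpd: "cp S g s (\<lambda>t. f t = F (g t)) = ?d (R s') / ?c s" by (simp add: cp_def)
    have cs: "?c s > 0" using card_fib_pos[OF fin s, of g] by simp
    have "1 - ?d (R s') / ?c s = (\<Sum>t\<in>fib S g s. 1 - ?d (R s') / ?c s) / ?c s"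
      using cs by simp
    also have "\<dots> \<le> (\<Sum>t\<in>fib S g s. ln (?c t / ?d t)) / ?c s"
    proof (intro divide_right_mono sum_mono)
      fix t assume t: "t \<in> fib S g s"
      then have tS: "t \<in> S" and ct: "?c t = ?c s" by (auto simp: fib_def)
      have p: "?d t > 0" using card_fib_pos[OF fin tS] by simp
      have "1 - ?d (R s') / ?c s \<le> 1 - ?d t / ?c s"
        using R(2)[OF s'(1)] t fibeq cs by (simp add: divide_right_mono)
      also have "\<dots> \<le> - ln (?d t / ?c s)"
        using ln_le_minus_one[of "?d t / ?c s"] p cs by simp
      also have "\<dots> = ln (?c t / ?d t)" using p cs ct by (simp add: ln_div)
      finally show "1 - ?d (R s') / ?c s \<le> ln (?c t / ?d t)" .
    qed auto
    finally show ?thesis by (simp add: cpd avg_def)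
  qed
  then have "(\<Sum>s\<in>S. 1 - cp S g s (\<lambda>t. f t = F (g t))) \<le> (\<Sum>s\<in>S. avg S g (\<lambda>t. ln (?c t / ?d t)) s)"
    by (intro sum_mono)
  also have "\<dots> = cent S f g * real (card S)"
    by (cases "S = {}") (auto simp: sum_avg[OF fin] cent_eq[OF fin] fin)
  also have "(\<Sum>s\<in>S. 1 - cp S g s (\<lambda>t. f t = F (g t))) = (\<Sum>s\<in>S. cp S g s (\<lambda>t. f t \<noteq> F (g t)))"
    by (intro sum.cong refl) (simp add: cp_compl[OF fin])
  also have "\<dots> = (\<Sum>s\<in>S. if f s \<noteq> F (g s) then 1 else 0)"
    unfolding cp_eq_avg[OF fin] by (rule sum_avg[OF fin])
  also have "\<dots> = real (card {s \<in> S. f s \<noteq> F (g s)})"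
    using fin by (subst sum.inter_filter[symmetric]) auto
  finally show ?thesis using that by blast
qed

text \<open>The pairs form a chain in the product order, so the sum of the two coordinates separates
  them.\<close>

lemma comonotone_image_card:
  fixes A B :: "'s \<Rightarrow> nat"
  assumes "\<And>s. s \<in> R \<Longrightarrow> A s < m" "\<And>s. s \<in> R \<Longrightarrow> B s < n"
    and "\<And>s t. s \<in> R \<Longrightarrow> t \<in> R \<Longrightarrow> A s < A t \<Longrightarrow> B s \<le> B t"
  shows "card ((A \<otimes> B) ` R) \<le> m + n"
proof -
  have "inj_on (\<lambda>(a, b). a + b) ((A \<otimes> B) ` R)"
  proof (rule inj_onI, clarsimp)
    fix s t assume "s \<in> R" "t \<in> R" "A s + B s = A t + B t"
    then show "A s = A t \<and> B s = B t"
      using assms(3)[of s t] assms(3)[of t s] by (cases "A s" "A t" rule: linorder_cases) auto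
  qed
  then have "card ((A \<otimes> B) ` R) = card ((\<lambda>(a, b). a + b) ` ((A \<otimes> B) ` R))"
    by (simp add: card_image)
  also have "\<dots> \<le> card {..<m + n}"
    using assms(1,2) by (intro card_mono) (auto intro!: add_strict_mono)
  finally show ?thesis by simp
qed

text \<open>A block of \<open>B\<close> on which \<open>C\<close> is not constant contains a jump of \<open>C\<close>, and there are fewer
  than \<open>m\<close> jumps; near-maximal entropy of \<open>B\<close> makes these few blocks negligible.\<close>
lemma ambiguous_block_bound:
  fixes B C :: "'s \<Rightarrow> nat"
  assumes fin: "finite S" and ne: "S \<noteq> {}"
    and Bn: "\<And>s. s \<in> S \<Longrightarrow> B s < n" and Cm: "\<And>s. s \<in> S \<Longrightarrow> C s < m"
    and mono: "\<And>s t. s \<in> S \<Longrightarrow> t \<in> S \<Longrightarrow> X s = X t \<Longrightarrow> B s < B t \<Longrightarrow> C s \<le> C t"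
    and big: "cent S B X \<ge> ln (real n) - k"
  shows "real (card {s \<in> S. \<exists>t\<in>S. X t = X s \<and> B t = B s \<and> C t \<noteq> C s}) / real (card S)
           * (ln (real n) - ln (real m)) \<le> k + ln 2"
proof -
  define K where "K x = {b. \<exists>s\<in>S. \<exists>t\<in>S. X s = x \<and> X t = x \<and> B s = b \<and> B t = b \<and> C s < C t}" for x
  have sets: "{s \<in> S. B s \<in> K (X s)} = {s \<in> S. \<exists>t\<in>S. X t = X s \<and> B t = B s \<and> C t \<noteq> C s}"
  proof (intro Collect_cong conj_cong refl iffI)
    fix s assume s: "s \<in> S" and "B s \<in> K (X s)"
    then obtain p q where "p \<in> S" "q \<in> S" "X p = X s" "X q = X s" "B p = B s" "B q = B s" "C p < C q"
      by (auto simp: K_def)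
    then show "\<exists>t\<in>S. X t = X s \<and> B t = B s \<and> C t \<noteq> C s" by (metis less_irrefl)
  next
    fix s assume "s \<in> S" and "\<exists>t\<in>S. X t = X s \<and> B t = B s \<and> C t \<noteq> C s"
    then show "B s \<in> K (X s)" unfolding K_def by simp (metis linorder_neq_iff)
  qed
  from ne obtain s0 where "s0 \<in> S" by auto
  then have mn: "m > 0" "n > 0" using Bn Cm by fastforce+
  have K: "finite (K (X s)) \<and> card (K (X s)) \<le> m" for s
  proof -
    let ?x = "X s"
    have "\<forall>b\<in>K ?x. \<exists>p q. p \<in> S \<and> q \<in> S \<and> X p = ?x \<and> X q = ?x \<and> B p = b \<and> B q = b \<and> C p < C q"
      by (auto simp: K_def)
    then obtain p q where pq: "\<And>b. b \<in> K ?x \<Longrightarrow> p b \<in> S \<and> q b \<in> S \<and> X (p b) = ?x \<and> X (q b) = ?x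
        \<and> B (p b) = b \<and> B (q b) = b \<and> C (p b) < C (q b)" by metis
    \<comment> \<open>The points \<open>p b\<close> and \<open>q b\<close> witness a jump of
      \<open>C\<close> inside block \<open>b\<close>; monotonicity puts the whole jump below those
      of later blocks.\<close>
    have lt: "C (p b) < C (p b')" if "b \<in> K ?x" "b' \<in> K ?x" "b < b'" for b b'
    proof -
      have "C (q b) \<le> C (p b')" using mono[of "q b" "p b'"] pq[OF that(1)] pq[OF that(2)] that(3) by auto
      then show ?thesis using pq[OF that(1)] by linarith
    qed
    have inj: "inj_on (\<lambda>b. C (p b)) (K ?x)"
    proof (rule inj_onI)
      fix b b' assume "b \<in> K ?x" "b' \<in> K ?x" "C (p b) = C (p b')"
      then show "b = b'" using lt[of b b'] lt[of b' b] by (cases b b' rule: linorder_cases) auto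
    qed
    have sub: "(\<lambda>b. C (p b)) ` K ?x \<subseteq> {..<m}" using pq Cm by auto
    have "finite (K ?x)" using inj sub by (metis finite_imageD finite_lessThan finite_subset)
    moreover have "card (K ?x) \<le> m"
      using card_inj_on_le[OF inj sub] by simp
    ultimately show ?thesis by simp
  qed
  have rng: "card (B ` fib S X s) \<le> n" for s
  proof -
    have "B ` fib S X s \<subseteq> {..<n}" using Bn by (auto simp: fib_def)
    then show ?thesis using card_mono[of "{..<n}"] by fastforce
  qed
  have "ln (real n) - k \<le> ln 2 + real (card {s \<in> S. B s \<in> K (X s)}) / real (card S) * ln (real m)
      + (1 - real (card {s \<in> S. B s \<in> K (X s)}) / real (card S)) * ln (real n)"
    by (rule order_trans[OF big cent_le_exceptional[of S m n K X B, OF fin ne mn K rng]])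
  then show ?thesis unfolding sets right_diff_distrib left_diff_distrib by linarith
qed

section \<open>Comparable sets and quantile blocks\<close>

definition comparable :: "'s set \<Rightarrow> ('s \<Rightarrow> int) \<Rightarrow> ('s \<Rightarrow> int) \<Rightarrow> ('s \<Rightarrow> int) \<Rightarrow> bool" where
  "comparable S X Y Z \<longleftrightarrow> (\<forall>s\<in>S. \<forall>t\<in>S. s \<noteq> t \<longrightarrow>
     (X s = X t \<longrightarrow> Y s < Y t \<and> Z s < Z t \<or> Y t < Y s \<and> Z t < Z s) \<and>
     (Y s = Y t \<longrightarrow> X s < X t \<and> Z s < Z t \<or> X t < X s \<and> Z t < Z s) \<and>
     (Z s = Z t \<longrightarrow> X s < X t \<and> Y s < Y t \<or> X t < X s \<and> Y t < Y s))"

text \<open>The two transpositions generate all permutations of the coordinates, so later facts are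
  stated for one order only.\<close>

lemma comparable_swap12: "comparable S X Y Z \<Longrightarrow> comparable S Y X Z"
  unfolding comparable_def by blast

lemma comparable_swap23: "comparable S X Y Z \<Longrightarrow> comparable S X Z Y"
  unfolding comparable_def by blast

lemma comparable_subset: "comparable S X Y Z \<Longrightarrow> R \<subseteq> S \<Longrightarrow> comparable R X Y Z"
  unfolding comparable_def by blast

lemma comparable_less:
  assumes "comparable S X Y Z" "s \<in> S" "t \<in> S" "X s = X t" "Y s < Y t"
  shows "Z s < Z t"
proof -
  have "s \<noteq> t" using assms(5) by auto
  then have "Y s < Y t \<and> Z s < Z t \<or> Y t < Y s \<and> Z t < Z s"
    using assms(1-4) unfolding comparable_def by blast
  with assms(5) show ?thesis by linarith
qed

lemma comparable_inj:
  assumes "comparable S X Y Z" "s \<in> S" "t \<in> S" "X s = X t" "Y s = Y t"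
  shows "s = t"
proof (rule ccontr)
  assume "s \<noteq> t"
  then have "Y s < Y t \<and> Z s < Z t \<or> Y t < Y s \<and> Z t < Z s"
    using assms(1-4) unfolding comparable_def by blast
  with assms(5) show False by linarith
qed

text \<open>Quantile blocks, of nearly equal size if no value of \<open>X\<close> is too frequent.
  The strict rank makes the block a function of the value of \<open>X\<close>, and rounding down
  makes the blocks of all scales exactly nested.\<close>

definition block :: "'s set \<Rightarrow> ('s \<Rightarrow> int) \<Rightarrow> nat \<Rightarrow> 's \<Rightarrow> nat" where
  "block S X i s = (2 ^ i * card {t \<in> S. X t < X s}) div card S"

lemma block_lt:
  assumes "finite S" "s \<in> S"
  shows "block S X i s < 2 ^ i"
proof -
  have "card {t \<in> S. X t < X s} < card S"
    using assms by (intro psubset_card_mono) auto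
  then show ?thesis unfolding block_def by (intro less_mult_imp_div_less) simp
qed

lemma block_mono:
  assumes "finite S" "X s \<le> X t"
  shows "block S X i s \<le> block S X i t"
proof -
  have "card {r \<in> S. X r < X s} \<le> card {r \<in> S. X r < X t}"
    using assms by (intro card_mono) auto
  then show ?thesis unfolding block_def by (intro div_le_mono) simp
qed

lemma block_less: "finite S \<Longrightarrow> block S X i s < block S X i t \<Longrightarrow> X s < X t"
  using block_mono[of S X t s i] by linarith

lemma block_refine:
  assumes "i \<le> j"
  shows "block S X i s = block S X j s div 2 ^ (j - i)"
proof -
  let ?r = "card {t \<in> S. X t < X s}"
  have "block S X j s div 2 ^ (j - i) = (2 ^ j * ?r) div (card S * 2 ^ (j - i))"
    by (simp add: block_def div_mult2_eq)
  also have "2 ^ j = (2 ^ (j - i) * 2 ^ i :: nat)"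
    using assms by (simp add: power_add[symmetric])
  also have "(2 ^ (j - i) * 2 ^ i * ?r) div (card S * 2 ^ (j - i)) = (2 ^ (j - i) * (2 ^ i * ?r)) div (2 ^ (j - i) * card S)"
    by (simp add: ac_simps)
  also have "\<dots> = block S X i s" unfolding block_def by simp
  finally show ?thesis by simp
qed

lemma block_eq_coarser: "i \<le> j \<Longrightarrow> block S X j s = block S X j t \<Longrightarrow> block S X i s = block S X i t"
  by (simp add: block_refine[of i j])

lemma block_determined: "X s = X t \<Longrightarrow> block S X i s = block S X i t"
  by (simp add: block_def)

lemma determines_block: "determines S X (block S X i)"
  unfolding determines_def by (blast intro: block_determined)

lemma determines_block_block: "i \<le> j \<Longrightarrow> determines S (block S X j) (block S X i)"
  unfolding determines_def by (blast intro: block_eq_coarser)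

text \<open>Apart from the points tied with the largest \<open>X\<close> in the block, a block is
  counted by a difference of two ranks, and equal quotients bound this difference by
  \<open>card S / 2 ^ i\<close>.\<close>

lemma block_fib_card:
  assumes fin: "finite S" and s: "s \<in> S" and atom: "\<And>t. t \<in> S \<Longrightarrow> card (fib S X t) \<le> a"
  shows "2 ^ i * card (fib S (block S X i) s) \<le> card S + 2 ^ i * a"
proof -
  let ?E = "fib S (block S X i) s" and ?r = "\<lambda>s. card {t \<in> S. X t < X s}"
  have ne: "X ` ?E \<noteq> {}" and fE: "finite (X ` ?E)" using s fin by (auto simp: fib_def)
  from Max_in[OF fE ne] obtain p where p: "p \<in> ?E" "X p = Max (X ` ?E)" by auto
  from Min_in[OF fE ne] obtain q where q: "q \<in> ?E" "X q = Min (X ` ?E)" by auto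
  have up: "X t \<le> X p" "X q \<le> X t" if "t \<in> ?E" for t using that fE p q by auto
  have pS: "p \<in> S" using p by (auto simp: fib_def)
  have "?E \<subseteq> {t \<in> S. X q \<le> X t \<and> X t < X p} \<union> fib S X p"
    using up by (fastforce simp: fib_def)
  then have "card ?E \<le> card ({t \<in> S. X q \<le> X t \<and> X t < X p} \<union> fib S X p)"
    using fin by (intro card_mono) auto
  also have "\<dots> \<le> card {t \<in> S. X q \<le> X t \<and> X t < X p} + a"
    using card_Un_le[of "{t \<in> S. X q \<le> X t \<and> X t < X p}" "fib S X p"] atom[OF pS] by linarith
  finally have 1: "card ?E \<le> card {t \<in> S. X q \<le> X t \<and> X t < X p} + a" .
  have qp: "X q \<le> X p" using up(1)[OF q(1)] .
  have rp: "?r p = ?r q + card {t \<in> S. X q \<le> X t \<and> X t < X p}"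
  proof -
    have "{t \<in> S. X t < X p} = {t \<in> S. X t < X q} \<union> {t \<in> S. X q \<le> X t \<and> X t < X p}"
      using qp by auto
    moreover have "card ({t \<in> S. X t < X q} \<union> {t \<in> S. X q \<le> X t \<and> X t < X p})
        = ?r q + card {t \<in> S. X q \<le> X t \<and> X t < X p}"
      using fin by (intro card_Un_disjoint) auto
    ultimately show ?thesis by metis
  qed
  have N: "card S > 0" using fin s by (auto simp: card_gt_0_iff)
  have "(2 ^ i * ?r p) div card S = (2 ^ i * ?r q) div card S"
    using p(1) q(1) by (simp add: fib_def block_def)
  then have "2 ^ i * ?r p < 2 ^ i * ?r q + card S"
  proof -
    have "a < b + n" if "a div n = b div n" "n > 0" for a b n :: nat
    proof -
      have "a = b div n * n + a mod n" using that div_mult_mod_eq[of a n] by simp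
      then show ?thesis using div_mult_mod_eq[of b n] mod_less_divisor[OF that(2), of a] by linarith
    qed
    then show ?thesis using N \<open>(2 ^ i * ?r p) div card S = (2 ^ i * ?r q) div card S\<close> by blast
  qed
  with rp have "2 ^ i * card {t \<in> S. X q \<le> X t \<and> X t < X p} \<le> card S"
    by (simp add: distrib_left)
  with 1 have "2 ^ i * card ?E \<le> 2 ^ i * (card {t \<in> S. X q \<le> X t \<and> X t < X p} + a)"
    by simp
  also have "\<dots> \<le> card S + 2 ^ i * a"
    using \<open>2 ^ i * card {t \<in> S. X q \<le> X t \<and> X t < X p} \<le> card S\<close> by (simp add: distrib_left)
  finally show ?thesis .
qed

lemma ln_2_pow: "ln (2 ^ i) = real i * ln 2"
  by (simp add: ln_realpow)

lemma cent_block_le: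
  assumes "finite S" "S \<noteq> {}"
  shows "cent S (block S X i) g \<le> real i * ln 2"
proof -
  have "cent S (block S X i) g \<le> ln (real (2 ^ i))"
  proof (rule cent_le_ln_card[OF assms])
    fix s
    have "block S X i ` fib S g s \<subseteq> {..<2 ^ i}"
      using block_lt[OF assms(1)] by (auto simp: fib_def)
    then show "card (block S X i ` fib S g s) \<le> 2 ^ i"
      using card_mono[of "{..<2 ^ i}" "block S X i ` fib S g s"] by simp
  qed
  then show ?thesis by (simp add: ln_2_pow)
qed

lemma ent_block_le: "finite S \<Longrightarrow> S \<noteq> {} \<Longrightarrow> ent S (block S X i) \<le> real i * ln 2"
  using cent_block_le[of S X i "\<lambda>_. ()"] by (simp add: ent_eq_cent)

lemma ent_block_diff:
  assumes fin: "finite S" and ne: "S \<noteq> {}" and ij: "i \<le> j"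
  shows "ent S (block S X j) \<le> ent S (block S X i) + (real j - real i) * ln 2"
proof -
  have "cent S (block S X j) (block S X i) \<le> ln (real (2 ^ (j - i)))"
  proof (rule cent_le_ln_card[OF fin ne])
    fix s assume "s \<in> S"
    let ?b = "block S X i s" and ?k = "2 ^ (j - i) :: nat"
    have "block S X j ` fib S (block S X i) s \<subseteq> {?b * ?k..<?b * ?k + ?k}"
    proof (rule image_subsetI)
      fix t assume "t \<in> fib S (block S X i) s"
      then have "block S X j t div ?k = ?b" using block_refine[OF ij, of S X t] by (simp add: fib_def)
      then have "block S X j t = ?b * ?k + block S X j t mod ?k" by (metis div_mult_mod_eq)
      moreover have "block S X j t mod ?k < ?k" by simp
      ultimately show "block S X j t \<in> {?b * ?k..<?b * ?k + ?k}"
        unfolding atLeastLessThan_iff by linarith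
    qed
    then show "card (block S X j ` fib S (block S X i) s) \<le> 2 ^ (j - i)"
      using card_mono[of "{?b * ?k..<?b * ?k + ?k}"] by fastforce
  qed
  moreover have "ent S (block S X j \<otimes> block S X i) = ent S (block S X j)"
    using determines_block_block[OF ij, of S X]
    by (intro ent_cong[OF fin]) (unfold determines_def, blast+)
  ultimately show ?thesis using ij by (simp add: cent_def ln_2_pow of_nat_diff)
qed

section \<open>Sets without an efficient partition\<close>

text \<open>With \<open>c = 0\<close> the partition into points always gives the reverse inequality, with equality
  iff \<open>X\<close>, \<open>Y\<close>, \<open>Z\<close> are pairwise independent. Quantifying over set-valued \<open>T\<close> loses nothing, since
  a partition may be represented by its parts.\<close>
definition no_gain :: "real \<Rightarrow> 's set \<Rightarrow> ('s \<Rightarrow> int) \<Rightarrow> ('s \<Rightarrow> int) \<Rightarrow> ('s \<Rightarrow> int) \<Rightarrow> bool" where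
  "no_gain c S X Y Z \<longleftrightarrow>
     (\<forall>T :: 's \<Rightarrow> 's set. (3 / 2 - c) * ent S T \<le> cent S T X + cent S T Y + cent S T Z)"

lemma no_gainD:
  assumes fin: "finite S" and "no_gain c S X Y Z"
  shows "(3 / 2 - c) * ent S T \<le> cent S T X + cent S T Y + cent S T Z"
proof -
  have eq: "fib S T s = fib S T t \<longleftrightarrow> T s = T t" if "s \<in> S" "t \<in> S" for s t
    using that by (auto simp: fib_def)
  have "ent S (fib S T) = ent S T"
    using eq by (intro ent_cong[OF fin]) (auto simp: determines_def)
  moreover have "cent S (fib S T) V = cent S T V" for V :: "'a \<Rightarrow> int"
    using eq by (intro cent_cong[OF fin]) (auto simp: determines_def)
  ultimately show ?thesis using assms(2) unfolding no_gain_def by metis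
qed

lemma no_gain_swap12: "no_gain c S X Y Z \<Longrightarrow> no_gain c S Y X Z"
  by (simp add: no_gain_def add.commute)

lemma no_gain_swap23: "no_gain c S X Y Z \<Longrightarrow> no_gain c S X Z Y"
  by (simp add: no_gain_def add.commute add.left_commute)

text \<open>Tested on the partition that isolates each point of one fibre of \<open>X\<close>.\<close>
lemma no_gain_atom:
  assumes fin: "finite S" and cmp: "comparable S X Y Z" and ng: "no_gain c S X Y Z"
    and c: "c \<le> 1 / 10" and s0: "s0 \<in> S"
  shows "5 * ln (real (card (fib S X s0))) \<le> 3 * (1 + ln (real (card S)))"
proof -
  define m where "m = real (card (fib S X s0))"
  define N where "N = real (card S)"
  have m1: "m \<ge> 1" using card_fib_pos[OF fin s0, of X] by (simp add: m_def)
  have mN: "m \<le> N" unfolding m_def N_def using fin fib_subset by (metis card_mono of_nat_le_iff)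
  define e where "e s = (X s = X s0)" for s
  \<comment> \<open>\<open>None\<close> lumps together everything off the fibre; on the fibre
    \<open>Y\<close>, and likewise \<open>Z\<close>, separates the points by comparability.\<close>
  define T where "T s = (if e s then Some (Y s) else None)" for s
  define h where "h = ent S e"
  define q where "q = cent S T e"
  have Te: "determines S T e" by (auto simp: determines_def T_def split: if_splits)
  have "ent S (T \<otimes> e) = ent S T"
    using Te by (intro ent_cong[OF fin]) (unfold determines_def, blast+)
  then have entT: "ent S T = h + q" by (simp add: h_def q_def cent_def)
  have cX: "cent S T X \<le> q"
    unfolding q_def by (rule cent_antimono_det[OF fin]) (simp add: determines_def e_def)
  have "cent S T Y \<le> cent S e Y"
    by (rule cent_mono_det[OF fin]) (simp add: determines_def T_def)
  then have cY: "cent S T Y \<le> h" using cent_le_ent[OF fin, of e Y] by (simp add: h_def)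
  have "determines S (e \<otimes> Z) T"
    unfolding determines_def
  proof (intro ballI impI)
    fix s t assume st: "s \<in> S" "t \<in> S" "(e s, Z s) = (e t, Z t)"
    show "T s = T t"
    proof (cases "e s")
      case True
      then have "X s = X t" "Z s = Z t" using st by (auto simp: e_def)
      then have "s = t" using comparable_inj[OF comparable_swap23[OF cmp] st(1,2)] by blast
      then show ?thesis by simp
    qed (use st in \<open>auto simp: T_def\<close>)
  qed
  then have "cent S T Z \<le> cent S e Z" by (rule cent_mono_det[OF fin])
  then have cZ: "cent S T Z \<le> h" using cent_le_ent[OF fin, of e Z] by (simp add: h_def)
  \<comment> \<open>\<open>X\<close> contributes at most \<open>q\<close>, while \<open>Y\<close>
    and \<open>Z\<close> contribute at most \<open>h\<close> each, so \<open>q\<close> cannot be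
    much larger than \<open>h\<close>.\<close>
  have main: "(3 / 2 - c) * (h + q) \<le> q + 2 * h"
    using no_gainD[OF fin ng, of T] cX cY cZ by (simp add: entT)
  have N0: "N > 0" using m1 mN by simp
  have fe: "fib S e s = (if e s then fib S X s0 else S - fib S X s0)" if "s \<in> S" for s
    by (auto simp: fib_def e_def)
  have fTe: "fib S (T \<otimes> e) s = (if e s then {s} else S - fib S X s0)" if s: "s \<in> S" for s
  proof (cases "e s")
    case True
    have "t = s" if "t \<in> S" "T t = T s" for t
    proof -
      have "e t" "Y t = Y s" using that True by (auto simp: T_def split: if_splits)
      then show ?thesis using comparable_inj[OF cmp that(1) s] True by (auto simp: e_def)
    qed
    then show ?thesis using True s by (auto simp: fib_def)
  next
    case False
    then show ?thesis by (auto simp: fib_def T_def e_def)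
  qed
  have "q = (\<Sum>s\<in>S. if e s then ln m else 0) / N"
    unfolding q_def cent_eq[OF fin] N_def
  proof (intro arg_cong2[where f = "(/)"] sum.cong refl)
    fix s assume s: "s \<in> S"
    show "ln (real (card (fib S e s)) / real (card (fib S (T \<otimes> e) s))) = (if e s then ln m else 0)"
      using card_fib_pos[OF fin s, of e] fe[OF s] fTe[OF s] by (auto simp: m_def)
  qed
  also have "(\<Sum>s\<in>S. if e s then ln m else 0) = m * ln m"
    using fin by (subst sum.inter_filter[symmetric]) (auto simp: m_def fib_def e_def)
  finally have q: "q = m * ln m / N" .
  \<comment> \<open>Off the fibre, \<open>- ln (1 - m / N) \<le> m / (N - m)\<close>. For
    \<open>N = m\<close> this quotient is 0 by convention, but then no point lies off the
    fibre.\<close>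
  have "h \<le> (\<Sum>s\<in>S. if e s then ln (N / m) else m / (N - m)) / N"
    unfolding h_def ent_def N_def[symmetric]
  proof (intro divide_right_mono sum_mono)
    fix s assume s: "s \<in> S"
    show "ln (N / real (card (fib S e s))) \<le> (if e s then ln (N / m) else m / (N - m))"
    proof (cases "e s")
      case True
      then show ?thesis using fe[OF s] by (simp add: m_def)
    next
      case False
      then have "real (card (fib S e s)) = N - m"
        using fe[OF s] fin fib_subset[of S X s0] mN
        by (simp add: card_Diff_subset m_def N_def of_nat_diff)
      moreover have "real (card (fib S e s)) > 0" using card_fib_pos[OF fin s, of e] by simp
      ultimately have p: "N - m > 0" "real (card (fib S e s)) = N - m" by auto
      have "ln (N / (N - m)) \<le> N / (N - m) - 1" using p N0 by (intro ln_le_minus_one) auto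
      also have "\<dots> = m / (N - m)" using p by (simp add: field_simps)
      finally show ?thesis using False p by simp
    qed
  qed (simp add: N_def)
  also have "(\<Sum>s\<in>S. if e s then ln (N / m) else m / (N - m))
      = (\<Sum>s\<in>{s \<in> S. e s}. ln (N / m)) + (\<Sum>s\<in>{s \<in> S. \<not> e s}. m / (N - m))"
    using fin by (simp add: sum.If_cases Int_def Collect_neg_eq[symmetric])
  also have "\<dots> = m * ln (N / m) + real (card (S - fib S X s0)) * (m / (N - m))"
  proof -
    have "{s \<in> S. e s} = fib S X s0" "{s \<in> S. \<not> e s} = S - fib S X s0" by (auto simp: fib_def e_def)
    then show ?thesis by (simp add: m_def)
  qed
  also have "real (card (S - fib S X s0)) = N - m"
    using fin fib_subset[of S X s0] mN by (simp add: card_Diff_subset m_def N_def of_nat_diff)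
  also have "m * ln (N / m) + (N - m) * (m / (N - m)) \<le> m * ln (N / m) + m"
    using m1 by (cases "N = m") auto
  finally have h: "h \<le> m * (ln (N / m) + 1) / N"
    using N0 by (simp add: divide_right_mono distrib_left)
  have h0: "h \<ge> 0" unfolding h_def by (rule ent_nonneg[OF fin])
  have q0: "q \<ge> 0" unfolding q_def by (rule cent_nonneg[OF fin])
  have "(1 / 2 - c) * q \<le> (1 / 2 + c) * h" using main by (simp add: algebra_simps)
  moreover have "2 / 5 * q \<le> (1 / 2 - c) * q" using c q0 by (intro mult_right_mono) auto
  moreover have "(1 / 2 + c) * h \<le> 3 / 5 * h" using c h0 by (intro mult_right_mono) auto
  ultimately have "2 / 5 * q \<le> 3 / 5 * h" by linarith
  also have "\<dots> \<le> 3 / 5 * (m * (ln (N / m) + 1) / N)" using h by simp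
  finally have "m / N * (2 / 5 * ln m) \<le> m / N * (3 / 5 * (ln (N / m) + 1))"
    unfolding q by (simp add: ac_simps)
  then have "2 * ln m \<le> 3 * (ln (N / m) + 1)"
    using m1 N0 by (subst (asm) mult_le_cancel_left_pos) auto
  moreover have "ln (N / m) = ln N - ln m" using m1 N0 by (simp add: ln_div)
  ultimately show ?thesis by (simp add: m_def N_def)
qed

text \<open>What a large set without an efficient partition would satisfy up to scale
  \<open>L\<close>. The bound on \<open>c * L\<close> keeps \<open>c * ent S T\<close> below a small
  multiple of \<open>ln 2\<close> when \<open>T\<close> consists of at most three blocks of scale up
  to \<open>L\<close>.\<close>

definition tight :: "nat \<Rightarrow> real \<Rightarrow> 's set \<Rightarrow> ('s \<Rightarrow> int) \<Rightarrow> ('s \<Rightarrow> int) \<Rightarrow> ('s \<Rightarrow> int) \<Rightarrow> bool" where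
  "tight L c S X Y Z \<longleftrightarrow> finite S \<and> S \<noteq> {} \<and> comparable S X Y Z \<and> no_gain c S X Y Z
     \<and> 0 \<le> c \<and> 100 * c * real L \<le> 1
     \<and> (\<forall>V\<in>{X, Y, Z}. (real L - 1 / 20) * ln 2 \<le> ent S (block S V L))"

lemma tight_swap12: "tight L c S X Y Z \<Longrightarrow> tight L c S Y X Z"
  unfolding tight_def by (auto intro: comparable_swap12 no_gain_swap12)

lemma tight_swap23: "tight L c S X Y Z \<Longrightarrow> tight L c S X Z Y"
  unfolding tight_def by (auto intro: comparable_swap23 no_gain_swap23)

text \<open>Each finer scale adds at most \<open>ln 2\<close> of entropy, so the deficit at scale
  \<open>i\<close> is no larger than at \<open>L\<close>.\<close>

lemma tight_ent_ge:
  assumes "tight L c S X Y Z" "i \<le> L"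
  shows "(real i - 1 / 20) * ln 2 \<le> ent S (block S X i)"
proof -
  have "ent S (block S X L) \<le> ent S (block S X i) + (real L - real i) * ln 2"
    using assms by (intro ent_block_diff) (auto simp: tight_def)
  moreover have "(real L - 1 / 20) * ln 2 \<le> ent S (block S X L)"
    using assms by (auto simp: tight_def)
  ultimately show ?thesis by (simp add: algebra_simps)
qed

lemma cent_block_pair_le:
  assumes fin: "finite S" and ne: "S \<noteq> {}" and cmp: "comparable S X Y Z"
  shows "cent S (block S X i \<otimes> block S Y i) Z \<le> (real i + 1) * ln 2"
proof -
  have "cent S (block S X i \<otimes> block S Y i) Z \<le> ln (real (2 ^ i + 2 ^ i))"
  proof (rule cent_le_ln_card[OF fin ne], rule comonotone_image_card)
    fix s r t assume "r \<in> fib S Z s" "t \<in> fib S Z s" "block S X i r < block S X i t"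
    then have "r \<in> S" "t \<in> S" "Z r = Z t" "X r < X t"
      using block_less[OF fin] by (auto simp: fib_def)
    then have "Y r < Y t"
      using comparable_less[OF comparable_swap12[OF comparable_swap23[OF cmp]]] by blast
    then show "block S Y i r \<le> block S Y i t" by (intro block_mono[OF fin]) simp
  qed (use block_lt[OF fin] in \<open>auto simp: fib_def\<close>)
  also have "real (2 ^ i + 2 ^ i) = 2 ^ (i + 1)" by simp
  finally show ?thesis unfolding ln_2_pow by (simp add: add.commute)
qed

text \<open>By the chain rule the pair of blocks has entropy at least about \<open>i * ln 2\<close>
  plus either conditional entropy. Then \<open>no_gain\<close> forces the two conditional entropies
  to have sum almost \<open>2 * i * ln 2\<close>, and neither exceeds
  \<open>i * ln 2\<close>.\<close>

lemma tight_pair: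
  assumes tg: "tight L c S X Y Z" and i: "i \<le> L"
  shows "(real i - 5) * ln 2 \<le> cent S (block S Y i) X"
    and "(real i - 5) * ln 2 \<le> cent S (block S X i) Y"
proof -
  have fin: "finite S" and ne: "S \<noteq> {}" and cmp: "comparable S X Y Z" and ng: "no_gain c S X Y Z"
    and c: "0 \<le> c" "100 * c * real L \<le> 1"
    using tg by (auto simp: tight_def)
  define l where "l = (ln 2 :: real)"
  have l: "l > 0" by (simp add: l_def)
  let ?A = "block S X i" and ?B = "block S Y i"
  define u where "u = cent S ?B X"
  define v where "v = cent S ?A Y"
  define h where "h = ent S (?A \<otimes> ?B)"
  define il where "il = real i * l"
  have dX: "determines S X ?A" and dY: "determines S Y ?B" by (rule determines_block)+
  have cX: "cent S (?A \<otimes> ?B) X = u"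
    unfolding u_def using dX by (intro cent_cong[OF fin]) (unfold determines_def, blast+)
  have cY: "cent S (?A \<otimes> ?B) Y = v"
    unfolding v_def using dY by (intro cent_cong[OF fin]) (unfold determines_def, blast+)
  have a: "il - l / 20 \<le> ent S ?A" using tight_ent_ge[OF tg i] by (simp add: l_def il_def algebra_simps)
  have b: "il - l / 20 \<le> ent S ?B"
    using tight_ent_ge[OF tight_swap12[OF tg] i] by (simp add: l_def il_def algebra_simps)
  have "ent S (?B \<otimes> ?A) = h"
    unfolding h_def by (intro ent_cong[OF fin]) (simp_all add: determines_def)
  then have "h = ent S ?A + cent S ?B ?A" by (simp add: cent_def)
  then have h1: "h \<ge> ent S ?A + u"
    unfolding u_def using cent_antimono_det[OF fin dX, of ?B] by simp
  have "h = ent S ?B + cent S ?A ?B" by (simp add: cent_def h_def)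
  then have h2: "h \<ge> ent S ?B + v"
    unfolding v_def using cent_antimono_det[OF fin dY, of ?A] by simp
  have u: "u \<le> il" and v: "v \<le> il"
    unfolding u_def v_def il_def l_def by (rule cent_block_le[OF fin ne])+
  have "h \<le> 2 * il"
    using \<open>h = ent S ?B + cent S ?A ?B\<close> ent_block_le[OF fin ne, of Y i] cent_block_le[OF fin ne, of X i ?B]
    by (simp add: il_def l_def)
  then have "c * h \<le> c * (2 * il)" using c by (intro mult_left_mono)
  also have "\<dots> \<le> 2 * (c * real L) * l"
    using i c l by (simp add: il_def mult_mono mult_left_mono mult_right_mono)
  also have "\<dots> \<le> 2 * (1 / 100) * l" using c l by (intro mult_right_mono mult_left_mono) auto
  finally have ch: "c * h \<le> l / 50" by simp
  have cZ: "cent S (?A \<otimes> ?B) Z \<le> il + l"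
    using cent_block_pair_le[OF fin ne cmp, of i] by (simp add: il_def l_def algebra_simps)
  have "(3 / 2 - c) * h \<le> u + v + (il + l)"
    using no_gainD[OF fin ng, of "?A \<otimes> ?B"] cX cY cZ by (simp add: h_def)
  then have "3 / 2 * h \<le> u + v + (il + l) + c * h" by (simp add: algebra_simps)
  \<comment> \<open>These inequalities give \<open>u + v \<ge> 2 * il - 4.38 * l\<close>.\<close>
  with ch a b h1 h2 u v l have "il - 5 * l \<le> u" "il - 5 * l \<le> v" by linarith+
  then show "(real i - 5) * ln 2 \<le> cent S (block S Y i) X" "(real i - 5) * ln 2 \<le> cent S (block S X i) Y"
    by (simp_all add: u_def v_def il_def l_def algebra_simps)
qed

text \<open>Each of the three conditional entropies of the triple of blocks is at most
  \<open>(i + 1) * ln 2\<close>, so \<open>no_gain\<close> bounds its entropy by about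
  \<open>2 * i * ln 2\<close>. The first two blocks already have that much, up to a
  constant.\<close>

lemma tight_triple:
  assumes tg: "tight L c S X Y Z" and i: "i \<le> L"
  shows "cent S (block S Z i) (block S X i \<otimes> block S Y i) \<le> 8 * ln 2"
proof -
  have fin: "finite S" and ne: "S \<noteq> {}" and cmp: "comparable S X Y Z" and ng: "no_gain c S X Y Z"
    and c: "0 \<le> c" "100 * c * real L \<le> 1"
    using tg by (auto simp: tight_def)
  define l where "l = (ln 2 :: real)"
  have l: "l > 0" by (simp add: l_def)
  define il where "il = real i * l"
  let ?A = "block S X i" and ?B = "block S Y i" and ?C = "block S Z i"
  let ?T = "?C \<otimes> (?A \<otimes> ?B)"
  define h where "h = ent S ?T"
  have dX: "determines S X ?A" and dY: "determines S Y ?B" and dZ: "determines S Z ?C"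
    by (rule determines_block)+
  have "cent S ?T X = cent S (?B \<otimes> ?C) X"
    using dX by (intro cent_cong[OF fin]) (unfold determines_def, blast+)
  then have cX: "cent S ?T X \<le> il + l"
    using cent_block_pair_le[OF fin ne, of Y Z X i] comparable_swap23[OF comparable_swap12[OF cmp]]
    by (simp add: il_def l_def algebra_simps)
  have "cent S ?T Y = cent S (?A \<otimes> ?C) Y"
    using dY by (intro cent_cong[OF fin]) (unfold determines_def, blast+)
  then have cY: "cent S ?T Y \<le> il + l"
    using cent_block_pair_le[OF fin ne, of X Z Y i] comparable_swap23[OF cmp]
    by (simp add: il_def l_def algebra_simps)
  have "cent S ?T Z = cent S (?A \<otimes> ?B) Z"
    using dZ by (intro cent_cong[OF fin]) (unfold determines_def, blast+)
  then have cZ: "cent S ?T Z \<le> il + l"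
    using cent_block_pair_le[OF fin ne cmp, of i] by (simp add: il_def l_def algebra_simps)
  have hAB: "h = ent S (?A \<otimes> ?B) + cent S ?C (?A \<otimes> ?B)" by (simp add: cent_def h_def)
  have AB: "ent S (?A \<otimes> ?B) = ent S ?B + cent S ?A ?B" by (simp add: cent_def)
  have "h \<le> 3 * il"
    using hAB AB ent_block_le[OF fin ne, of Y i] cent_block_le[OF fin ne, of X i ?B]
      cent_block_le[OF fin ne, of Z i "?A \<otimes> ?B"] by (simp add: il_def l_def)
  then have "c * h \<le> c * (3 * il)" using c by (intro mult_left_mono)
  also have "\<dots> \<le> 3 * (c * real L) * l"
    using i c l by (simp add: il_def mult_mono mult_left_mono mult_right_mono)
  also have "\<dots> \<le> 3 * (1 / 100) * l" using c l by (intro mult_right_mono mult_left_mono) auto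
  finally have ch: "c * h \<le> 3 * l / 100" by simp
  have "(3 / 2 - c) * h \<le> 3 * (il + l)"
    using no_gainD[OF fin ng, of ?T] cX cY cZ by (simp add: h_def)
  then have "3 / 2 * h \<le> 3 * (il + l) + c * h" by (simp add: algebra_simps)
  then have "3 / 2 * h \<le> 3 * (il + l) + 3 * l / 100" using ch by linarith
  then have h: "h \<le> 2 * il + 2 * l + l / 50" by (simp add: field_simps)
  have "ent S ?B \<ge> il - l / 20"
    using tight_ent_ge[OF tight_swap12[OF tg] i] by (simp add: l_def il_def algebra_simps)
  moreover have "cent S ?A ?B \<ge> il - 5 * l"
    using tight_pair(2)[OF tg i] cent_antimono_det[OF fin dY, of ?A] by (simp add: l_def il_def algebra_simps)
  ultimately show ?thesis using hAB AB h l unfolding l_def[symmetric] by linarith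
qed

section \<open>Pigeonhole over scales and mutual information\<close>

lemma small_increment:
  fixes f :: "nat \<Rightarrow> real"
  assumes "K > 0"
  obtains k where "k < K" "f (Suc k) - f k \<le> (f K - f 0) / real K"
proof -
  have "\<exists>k<K. f (Suc k) - f k \<le> (f K - f 0) / real K"
  proof (rule ccontr)
    assume "\<not> ?thesis"
    then have "(\<Sum>k<K. (f K - f 0) / real K) < (\<Sum>k<K. f (Suc k) - f k)"
      using assms by (intro sum_strict_mono) (auto simp: not_le)
    also have "\<dots> = f K - f 0" by (rule sum_lessThan_telescope)
    finally show False using assms by simp
  qed
  then show ?thesis using that by blast
qed

definition minfo :: "'s set \<Rightarrow> ('s \<Rightarrow> 'a) \<Rightarrow> ('s \<Rightarrow> 'b) \<Rightarrow> real" where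
  "minfo S f g = ent S f - cent S f g"

text \<open>Both sides are the conditional mutual information of \<open>u\<close> and
  \<open>v\<close> given \<open>w\<close>, the quantity that \<open>close_markov\<close> needs to be
  small.\<close>

lemma cminfo_sym:
  assumes "finite S"
  shows "cent S v w - cent S v (u \<otimes> w) = cent S u w - cent S u (v \<otimes> w)"
proof -
  have "ent S (v \<otimes> (u \<otimes> w)) = ent S (u \<otimes> (v \<otimes> w))"
    by (intro ent_cong[OF assms]) (auto simp: determines_def)
  then show ?thesis by (simp add: cent_def)
qed

text \<open>Chain rule for mutual information. Little growth from \<open>f\<close> to its refinement
  \<open>f'\<close> thus means that \<open>f'\<close> and \<open>g\<close> are nearly independent
  given \<open>f\<close>.\<close>

lemma minfo_diff:
  assumes fin: "finite S" and det: "determines S f' f"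
  shows "minfo S f' g - minfo S f g = cent S f' f - cent S f' (g \<otimes> f)"
proof -
  have "ent S (f' \<otimes> f) = ent S f'"
    using det by (intro ent_cong[OF fin]) (unfold determines_def, blast+)
  moreover have "ent S (f' \<otimes> (g \<otimes> f)) = ent S (f' \<otimes> g)"
    using det by (intro ent_cong[OF fin]) (unfold determines_def, blast+)
  moreover have "ent S (f \<otimes> g) = ent S (g \<otimes> f)"
    by (intro ent_cong[OF fin]) (auto simp: determines_def)
  ultimately show ?thesis by (simp add: minfo_def cent_def)
qed

lemma minfo_mono:
  assumes "finite S" "determines S f' f"
  shows "minfo S f g \<le> minfo S f' g"
  using minfo_diff[OF assms, of g] cent_antimono[OF assms(1), of f' g f] by simp

text \<open>Conditioning also on a function \<open>D\<close> of \<open>g\<close> and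
  \<open>f\<close> only splits off the information carried by \<open>D\<close>. This permits
  conditioning on \<open>G\<close> and \<open>G'\<close> in the squeezing argument.\<close>

lemma cminfo_le_minfo_diff:
  assumes fin: "finite S" and det: "determines S f' f" and D: "determines S (g \<otimes> f) D"
  shows "cent S g (D \<otimes> f) - cent S g (f' \<otimes> (D \<otimes> f)) \<le> minfo S f' g - minfo S f g"
proof -
  have "cent S g (D \<otimes> f) - cent S g (f' \<otimes> (D \<otimes> f)) = cent S f' (D \<otimes> f) - cent S f' (g \<otimes> (D \<otimes> f))"
    by (rule cminfo_sym[OF fin])
  also have "cent S f' (g \<otimes> (D \<otimes> f)) = cent S f' (g \<otimes> f)"
    using D by (intro cent_cong[OF fin]) (unfold determines_def, blast+)
  finally show ?thesis
    using cent_antimono[OF fin, of f' D f] minfo_diff[OF fin det, of g] by simp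
qed

text \<open>The bound does not depend on the scale, which makes a pigeonhole over scales
  possible.\<close>

lemma minfo_block_le:
  assumes "tight L c S X Y Z" "i \<le> L"
  shows "minfo S (block S Y i) X \<le> 5 * ln 2"
  using tight_pair(1)[OF assms] ent_block_le[of S Y i] assms(1)
  by (simp add: minfo_def tight_def algebra_simps)

lemma minfo_nonneg: "finite S \<Longrightarrow> minfo S f g \<ge> 0"
  by (simp add: minfo_def cent_le_ent)

section \<open>The squeezing argument\<close>

text \<open>Given \<open>W\<close>, the values of \<open>V\<close> at points with
  \<open>\<Omega>\<close> in either cell have probability at least \<open>1 - 2 * \<theta>\<close>,
  more than one half, so some value occurs in both cells. Comparability applies to the resulting two
  points.\<close>

lemma joint_pair:
  assumes fin: "finite S" and st: "s \<in> S" "t \<in> S" and W: "W s = W t"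
    and cl: "close S V U W \<theta> s" "close S V U W \<theta> t"
    and bad: "cp S (U \<otimes> W) s (\<lambda>r. \<not> \<Omega> r) \<le> \<theta>" "cp S (U \<otimes> W) t (\<lambda>r. \<not> \<Omega> r) \<le> \<theta>"
    and \<theta>: "\<theta> < 1 / 4"
  obtains s' t' where "s' \<in> S" "t' \<in> S" "\<Omega> s'" "\<Omega> t'" "V s' = V t'"
    "U s' = U s" "W s' = W s" "U t' = U t" "W t' = W t"
proof -
  define K where "K s = V ` {r \<in> S. \<Omega> r \<and> U r = U s \<and> W r = W s}" for s
  have large: "1 - 2 * \<theta> \<le> cp S W r (\<lambda>t. V t \<in> K r)"
    if "r \<in> S" "close S V U W \<theta> r" "cp S (U \<otimes> W) r (\<lambda>r. \<not> \<Omega> r) \<le> \<theta>" for r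
  proof -
    have "1 - \<theta> \<le> cp S (U \<otimes> W) r \<Omega>"
      using cp_compl[OF fin that(1), of "U \<otimes> W" \<Omega>] that(3) by simp
    also have "\<dots> \<le> cp S (U \<otimes> W) r (\<lambda>t. V t \<in> K r)"
      by (rule cp_mono[OF fin]) (auto simp: K_def)
    also have "\<dots> \<le> cp S W r (\<lambda>t. V t \<in> K r) + \<theta>"
      using that(2) unfolding close_def by blast
    finally show ?thesis by simp
  qed
  have "cp S W t (\<lambda>r. V r \<in> K t) = cp S W s (\<lambda>r. V r \<in> K t)"
    by (rule cp_cong[of W t s]) (simp add: W)
  then have "cp S W s (\<lambda>r. V r \<in> K s) + cp S W s (\<lambda>r. V r \<in> K t) > 1"
    using large[OF st(1) cl(1) bad(1)] large[OF st(2) cl(2) bad(2)] \<theta> by linarith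
  from cp_both_ex[OF fin st(1) this] obtain r where "V r \<in> K s" "V r \<in> K t" by blast
  then obtain s' t' where "V r = V s'" "s' \<in> S" "\<Omega> s'" "U s' = U s" "W s' = W s"
    and "V r = V t'" "t' \<in> S" "\<Omega> t'" "U t' = U t" "W t' = W t"
    unfolding K_def by auto
  then show ?thesis using that[of s' t'] by simp
qed

text \<open>The blocks \<open>A1\<close>, \<open>B2\<close>, \<open>C0\<close> are coarser than \<open>A\<close>, \<open>B\<close>, \<open>C\<close>. The functions \<open>G\<close> and \<open>G'\<close> are
  versions of \<open>C0\<close> determined by \<open>(X, B2)\<close> and \<open>(Y, A1)\<close>; conditioning on them instead of \<open>C0\<close>
  does not spoil the near independence of \<open>X\<close> and \<open>B\<close>, and of \<open>Y\<close> and \<open>A\<close>.\<close>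
locale squeeze =
  fixes S :: "'s set" and X :: "'s \<Rightarrow> int" and Y :: "'s \<Rightarrow> int" and Z :: "'s \<Rightarrow> int"
    and A B A1 B2 C C0 G G' :: "'s \<Rightarrow> nat" and F :: "nat \<Rightarrow> nat \<Rightarrow> nat \<Rightarrow> nat"
  assumes fin: "finite S" and ne: "S \<noteq> {}"
    and monoZ: "\<And>s t. s \<in> S \<Longrightarrow> t \<in> S \<Longrightarrow> Z s = Z t \<Longrightarrow> A s < A t \<Longrightarrow> B s \<le> B t"
    and monoY: "\<And>s t. s \<in> S \<Longrightarrow> t \<in> S \<Longrightarrow> Y s = Y t \<Longrightarrow> A s < A t \<Longrightarrow> C s \<le> C t"
    and monoX: "\<And>s t. s \<in> S \<Longrightarrow> t \<in> S \<Longrightarrow> X s = X t \<Longrightarrow> B s < B t \<Longrightarrow> C s \<le> C t"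
    and A1: "\<And>s t. A s = A t \<Longrightarrow> A1 s = A1 t"
    and B2: "\<And>s t. B s = B t \<Longrightarrow> B2 s = B2 t"
    and YB: "\<And>s t. Y s = Y t \<Longrightarrow> B s = B t"
    and ZC: "\<And>s t. Z s = Z t \<Longrightarrow> C s = C t"
    and ZC0: "\<And>s t. Z s = Z t \<Longrightarrow> C0 s = C0 t"
    and G': "\<And>s t. s \<in> S \<Longrightarrow> t \<in> S \<Longrightarrow> Y s = Y t \<Longrightarrow> A1 s = A1 t \<Longrightarrow> G' s = G' t"
begin

definition ok :: "'s \<Rightarrow> bool" where
  "ok s \<longleftrightarrow> C s = F (A s) (B s) (C0 s) \<and> G s = C0 s \<and> G' s = C0 s"

text \<open>What \<open>joint_pair\<close> requires of a point when cells with the same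
  \<open>A\<close> are compared; \<open>goodY\<close> serves for cells with the same
  \<open>B\<close>.\<close>

definition goodX :: "'s \<Rightarrow> bool" where
  "goodX s \<longleftrightarrow> close S X B ((A \<otimes> G) \<otimes> B2) (1 / 16) s
      \<and> cp S (B \<otimes> ((A \<otimes> G) \<otimes> B2)) s (\<lambda>r. \<not> ok r) \<le> 1 / 16"

definition goodY :: "'s \<Rightarrow> bool" where
  "goodY s \<longleftrightarrow> close S Y A ((B \<otimes> G') \<otimes> A1) (1 / 16) s
      \<and> cp S (A \<otimes> ((B \<otimes> G') \<otimes> A1)) s (\<lambda>r. \<not> ok r) \<le> 1 / 16"

definition good :: "'s \<Rightarrow> bool" where
  "good s \<longleftrightarrow> ok s \<and> goodX s \<and> goodY s"

text \<open>\<open>joint_pair\<close> replaces \<open>s\<close> and \<open>t\<close> by points of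
  the same cells with a common \<open>Y\<close>, where \<open>monoY\<close> compares the values of
  \<open>C\<close>. \<open>F_mono_B\<close> uses a common \<open>X\<close> instead.\<close>

lemma F_mono_A:
  assumes "s \<in> S" "t \<in> S" "good s" "good t" "B s = B t" "C0 s = C0 t" "A1 s = A1 t" "A s < A t"
  shows "F (A s) (B s) (C0 s) \<le> F (A t) (B t) (C0 t)"
proof -
  have W: "((B \<otimes> G') \<otimes> A1) s = ((B \<otimes> G') \<otimes> A1) t"
    using assms by (simp add: good_def ok_def)
  obtain s' t' where *: "s' \<in> S" "t' \<in> S" "ok s'" "ok t'" "Y s' = Y t'"
    "A s' = A s" "((B \<otimes> G') \<otimes> A1) s' = ((B \<otimes> G') \<otimes> A1) s"
    "A t' = A t" "((B \<otimes> G') \<otimes> A1) t' = ((B \<otimes> G') \<otimes> A1) t"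
    using assms by (elim joint_pair[OF fin assms(1,2) W, of Y A "1 / 16" ok, rotated -1])
      (auto simp: good_def goodY_def)
  have "C s' \<le> C t'" using monoY[of s' t'] * assms(8) by simp
  moreover have "C s' = F (A s) (B s) (C0 s)" "C t' = F (A t) (B t) (C0 t)"
    using * assms(3,4) by (auto simp: ok_def good_def)
  ultimately show ?thesis by simp
qed

lemma F_mono_B:
  assumes "s \<in> S" "t \<in> S" "good s" "good t" "A s = A t" "C0 s = C0 t" "B2 s = B2 t" "B s \<le> B t"
  shows "F (A s) (B s) (C0 s) \<le> F (A t) (B t) (C0 t)"
proof (cases "B s = B t")
  case True
  then show ?thesis using assms by simp
next
  case False
  have W: "((A \<otimes> G) \<otimes> B2) s = ((A \<otimes> G) \<otimes> B2) t"
    using assms by (simp add: good_def ok_def)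
  obtain s' t' where *: "s' \<in> S" "t' \<in> S" "ok s'" "ok t'" "X s' = X t'"
    "B s' = B s" "((A \<otimes> G) \<otimes> B2) s' = ((A \<otimes> G) \<otimes> B2) s"
    "B t' = B t" "((A \<otimes> G) \<otimes> B2) t' = ((A \<otimes> G) \<otimes> B2) t"
    using assms by (elim joint_pair[OF fin assms(1,2) W, of X B "1 / 16" ok, rotated -1])
      (auto simp: good_def goodX_def)
  have "C s' \<le> C t'" using monoX[of s' t'] * assms(8) False by simp
  moreover have "C s' = F (A s) (B s) (C0 s)" "C t' = F (A t) (B t) (C0 t)"
    using * assms(3,4) by (auto simp: ok_def good_def)
  ultimately show ?thesis by simp
qed

text \<open>If \<open>A s < A t\<close> then \<open>C s = F (cell s) \<le> F (cell r) \<le> F (cell t) = C t = C s\<close>, where the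
  middle cell has the \<open>A\<close>-coordinate of \<open>t\<close> and the \<open>B\<close>-coordinate of \<open>s\<close>.\<close>
lemma squeeze_cell:
  assumes s: "s \<in> S" "good s" and t: "t \<in> S" "good t" and r: "r \<in> S" "good r"
    and Z: "Z s = Z t" and st: "A1 s = A1 t" "B2 s = B2 t"
    and cell: "A r = A t" "B r = B s" "C0 r = C0 s"
  shows "F (A t) (B s) (C0 s) = C s"
proof -
  have C0: "C0 s = C0 t" using ZC0[OF Z] .
  have Cs: "C s = F (A s) (B s) (C0 s)" and Ct: "C t = F (A t) (B t) (C0 t)"
    using s t by (auto simp: good_def ok_def)
  have CC: "C s = C t" using ZC[OF Z] .
  have A1r: "A1 r = A1 s" using A1[OF cell(1)] st by simp
  have B2r: "B2 r = B2 t" using B2[OF cell(2)] st by simp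
  consider "A s < A t" | "A s = A t" | "A t < A s" by linarith
  then show ?thesis
  proof cases
    case 1
    have "B s \<le> B t" using monoZ[OF s(1) t(1) Z 1] .
    then have "F (A r) (B r) (C0 r) \<le> F (A t) (B t) (C0 t)"
      using F_mono_B[OF r(1) t(1) r(2) t(2)] cell B2r C0 by simp
    moreover have "F (A s) (B s) (C0 s) \<le> F (A r) (B r) (C0 r)"
      using F_mono_A[OF s(1) r(1) s(2) r(2)] cell A1r 1 by simp
    ultimately show ?thesis using cell Cs Ct CC by simp
  next
    case 2
    then show ?thesis using Cs by simp
  next
    case 3
    have "B t \<le> B s" using monoZ[OF t(1) s(1) Z[symmetric] 3] .
    then have "F (A t) (B t) (C0 t) \<le> F (A r) (B r) (C0 r)"
      using F_mono_B[OF t(1) r(1) t(2) r(2)] cell B2r C0 by simp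
    moreover have "F (A r) (B r) (C0 r) \<le> F (A s) (B s) (C0 s)"
      using F_mono_A[OF r(1) s(1) r(2) s(2)] cell A1r 3 by simp
    ultimately show ?thesis using cell Cs Ct CC by simp
  qed
qed

definition typical :: "'s \<Rightarrow> bool" where
  "typical s \<longleftrightarrow> good s \<and> cp S (Y \<otimes> A1) s (\<lambda>r. \<not> good r) \<le> 1 / 16
     \<and> cp S (Z \<otimes> A1) s (\<lambda>r. \<not> good r) \<le> 1 / 16
     \<and> close S A Y A1 (1 / 16) s \<and> close S A Z A1 (1 / 16) s
     \<and> (\<forall>t\<in>S. Z t = Z s \<and> A1 t = A1 s \<longrightarrow> B2 t = B2 s)"

text \<open>\<open>E\<close> consists of the columns in which the row of \<open>s\<close> has a good
  point over \<open>C0 s\<close>. Most columns are in \<open>E\<close> given \<open>Y\<close> and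
  \<open>A1\<close>; near independence carries this to \<open>A1\<close> alone and on to
  \<open>Z\<close>, where \<open>squeeze_cell\<close> applies, and then back to
  \<open>A1\<close>.\<close>

lemma typical_majority:
  assumes s: "s \<in> S" and tp: "typical s"
  shows "cp S A1 s (\<lambda>t. F (A t) (B s) (C0 s) = C s) > 1 / 2"
proof -
  have gs: "good s" using tp by (simp add: typical_def)
  define E where "E = {a. \<exists>r\<in>S. good r \<and> A r = a \<and> B r = B s \<and> C0 r = C0 s}"
  define J where "J = {a. F a (B s) (C0 s) = C s}"
  have "1 - 1 / 16 \<le> cp S (Y \<otimes> A1) s good"
    using tp cp_compl[OF fin s, of "Y \<otimes> A1" good] by (simp add: typical_def)
  also have "\<dots> \<le> cp S (Y \<otimes> A1) s (\<lambda>t. A t \<in> E)"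
  proof (rule cp_mono[OF fin])
    fix t assume t: "t \<in> S" "(Y \<otimes> A1) t = (Y \<otimes> A1) s" "good t"
    then have "Y t = Y s" "A1 t = A1 s" by auto
    then have "B t = B s" "G' t = G' s" using YB[of t s] G'[OF t(1) s] by blast+
    moreover have "C0 t = C0 s" using \<open>G' t = G' s\<close> t(3) gs by (simp add: good_def ok_def)
    ultimately show "A t \<in> E" using t by (auto simp: E_def)
  qed
  also have "\<dots> \<le> cp S A1 s (\<lambda>t. A t \<in> E) + 1 / 16"
    using tp unfolding typical_def close_def by blast
  \<comment> \<open>Each transfer or exception costs \<open>1 / 16\<close>: the bounds run through
    15/16, 14/16, 13/16, 12/16 and end at 11/16, still above one half.\<close>
  finally have 1: "cp S A1 s (\<lambda>t. A t \<in> E) \<ge> 7 / 8" by simp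
  have 2: "cp S (Z \<otimes> A1) s (\<lambda>t. A t \<in> E) \<ge> 13 / 16"
    using close_lower[OF fin s, of A Z A1 "1 / 16" E] 1 tp by (simp add: typical_def)
  have "cp S (Z \<otimes> A1) s good \<ge> 15 / 16"
    using tp cp_compl[OF fin s, of "Z \<otimes> A1" good] by (simp add: typical_def)
  with 2 have "7 / 4 \<le> cp S (Z \<otimes> A1) s (\<lambda>t. A t \<in> E) + cp S (Z \<otimes> A1) s good" by simp
  also have "\<dots> \<le> 1 + cp S (Z \<otimes> A1) s (\<lambda>t. A t \<in> E \<and> good t)"
  proof -
    have "1 - cp S (Z \<otimes> A1) s (\<lambda>t. A t \<in> E \<and> good t) = cp S (Z \<otimes> A1) s (\<lambda>t. \<not> (A t \<in> E) \<or> \<not> good t)"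
      using cp_compl[OF fin s, of "Z \<otimes> A1" "\<lambda>t. A t \<in> E \<and> good t"] by simp
    also have "\<dots> \<le> cp S (Z \<otimes> A1) s (\<lambda>t. \<not> (A t \<in> E)) + cp S (Z \<otimes> A1) s (\<lambda>t. \<not> good t)"
      by (rule cp_disj[OF fin])
    finally show ?thesis
      using cp_compl[OF fin s, of "Z \<otimes> A1" "\<lambda>t. A t \<in> E"] cp_compl[OF fin s, of "Z \<otimes> A1" good] by linarith
  qed
  also have "cp S (Z \<otimes> A1) s (\<lambda>t. A t \<in> E \<and> good t) \<le> cp S (Z \<otimes> A1) s (\<lambda>t. A t \<in> J)"
  proof (rule cp_mono[OF fin])
    fix t assume t: "t \<in> S" "(Z \<otimes> A1) t = (Z \<otimes> A1) s" "A t \<in> E \<and> good t"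
    then obtain r where r: "r \<in> S" "good r" "A r = A t" "B r = B s" "C0 r = C0 s"
      by (auto simp: E_def)
    have "B2 s = B2 t" using tp t by (simp add: typical_def)
    then show "A t \<in> J"
      using squeeze_cell[OF s gs t(1) _ r(1,2) _ _ _ r(3,4,5)] t by (simp add: J_def)
  qed
  finally have "cp S (Z \<otimes> A1) s (\<lambda>t. A t \<in> J) \<ge> 3 / 4" by simp
  moreover have "cp S (Z \<otimes> A1) s (\<lambda>t. A t \<in> J) \<le> cp S A1 s (\<lambda>t. A t \<in> J) + 1 / 16"
    using tp unfolding typical_def close_def by blast
  ultimately show ?thesis by (simp add: J_def)
qed

text \<open>\<open>B\<close>, \<open>C0\<close> and \<open>A1\<close> agree at \<open>s\<close> and
  \<open>t\<close>, so both majorities concern the same function of \<open>A\<close>, and two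
  majorities share a point.\<close>

lemma typical_determined:
  assumes "s \<in> S" "typical s" "t \<in> S" "typical t" "Y s = Y t" "A1 s = A1 t"
  shows "C s = C t"
proof -
  have "B t = B s" using YB[OF assms(5)] by simp
  moreover have "C0 t = C0 s"
    using G'[OF assms(1,3,5,6)] assms(2,4) by (simp add: typical_def good_def ok_def)
  ultimately have "cp S A1 t (\<lambda>r. F (A r) (B s) (C0 s) = C t) > 1 / 2"
    using typical_majority[OF assms(3,4)] by simp
  then have "cp S A1 s (\<lambda>r. F (A r) (B s) (C0 s) = C s) + cp S A1 s (\<lambda>r. F (A r) (B s) (C0 s) = C t) > 1"
    using typical_majority[OF assms(1,2)] cp_cong[of A1 s t S, OF assms(6)] by simp
  then show ?thesis by (elim cp_both_ex[OF fin assms(1)]) simp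
qed

text \<open>Union bound, with Markov's inequality at threshold \<open>1 / 16\<close>. The two
  conditions on the proportion of good points cost 16 times the bound for \<open>good\<close>, hence
  the large constants.\<close>

lemma card_not_typical:
  assumes N: "N = real (card S)"
    and ok: "real (card {s \<in> S. \<not> ok s}) \<le> e * N" "0 \<le> e"
    and amb: "real (card {s \<in> S. \<exists>t\<in>S. Z t = Z s \<and> A1 t = A1 s \<and> B2 t \<noteq> B2 s}) \<le> e * N"
    and d: "0 < d"
    and "cent S X ((A \<otimes> G) \<otimes> B2) - cent S X (B \<otimes> ((A \<otimes> G) \<otimes> B2)) \<le> d\<^sup>2 / 2"
    and "cent S Y ((B \<otimes> G') \<otimes> A1) - cent S Y (A \<otimes> ((B \<otimes> G') \<otimes> A1)) \<le> d\<^sup>2 / 2"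
    and "cent S A A1 - cent S A (Y \<otimes> A1) \<le> d\<^sup>2 / 2"
    and "cent S A A1 - cent S A (Z \<otimes> A1) \<le> d\<^sup>2 / 2"
  shows "real (card {s \<in> S. \<not> typical s}) \<le> (1100 * e + 1100 * d) * N"
proof -
  let ?n = "\<lambda>P. real (card {s \<in> S. P s})"
  have N0: "N \<ge> 0" using N by simp
  have disj: "?n (\<lambda>s. P s \<or> Q s) \<le> ?n P + ?n Q" for P Q
  proof -
    have "{s \<in> S. P s \<or> Q s} = {s \<in> S. P s} \<union> {s \<in> S. Q s}" by auto
    then have "card {s \<in> S. P s \<or> Q s} \<le> card {s \<in> S. P s} + card {s \<in> S. Q s}"
      by (simp add: card_Un_le)
    then show ?thesis by linarith
  qed
  have clX: "?n (\<lambda>s. \<not> close S X B ((A \<otimes> G) \<otimes> B2) (1 / 16) s) \<le> 16 * (d * N)"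
    using close_markov[OF fin ne, of "1 / 16" d X "(A \<otimes> G) \<otimes> B2" B] assms by simp
  have clY: "?n (\<lambda>s. \<not> close S Y A ((B \<otimes> G') \<otimes> A1) (1 / 16) s) \<le> 16 * (d * N)"
    using close_markov[OF fin ne, of "1 / 16" d Y "(B \<otimes> G') \<otimes> A1" A] assms by simp
  have clAY: "?n (\<lambda>s. \<not> close S A Y A1 (1 / 16) s) \<le> 16 * (d * N)"
    using close_markov[OF fin ne, of "1 / 16" d A A1 Y] assms by simp
  have clAZ: "?n (\<lambda>s. \<not> close S A Z A1 (1 / 16) s) \<le> 16 * (d * N)"
    using close_markov[OF fin ne, of "1 / 16" d A A1 Z] assms by simp
  have mX: "?n (\<lambda>s. \<not> cp S (B \<otimes> ((A \<otimes> G) \<otimes> B2)) s (\<lambda>r. \<not> ok r) \<le> 1 / 16) \<le> 16 * (e * N)"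
    using cp_markov[OF fin, of "1 / 16" "B \<otimes> ((A \<otimes> G) \<otimes> B2)" "\<lambda>r. \<not> ok r"] ok by (simp add: not_le)
  have mY: "?n (\<lambda>s. \<not> cp S (A \<otimes> ((B \<otimes> G') \<otimes> A1)) s (\<lambda>r. \<not> ok r) \<le> 1 / 16) \<le> 16 * (e * N)"
    using cp_markov[OF fin, of "1 / 16" "A \<otimes> ((B \<otimes> G') \<otimes> A1)" "\<lambda>r. \<not> ok r"] ok by (simp add: not_le)
  have gX: "?n (\<lambda>s. \<not> goodX s) \<le> 16 * (d * N) + 16 * (e * N)"
    unfolding goodX_def de_Morgan_conj using disj clX mX by (meson add_mono order_trans)
  have gY: "?n (\<lambda>s. \<not> goodY s) \<le> 16 * (d * N) + 16 * (e * N)"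
    unfolding goodY_def de_Morgan_conj using disj clY mY by (meson add_mono order_trans)
  have g: "?n (\<lambda>s. \<not> good s) \<le> 32 * (d * N) + 33 * (e * N)"
    unfolding good_def de_Morgan_conj
    using disj[of "\<lambda>s. \<not> ok s" "\<lambda>s. \<not> goodX s \<or> \<not> goodY s"] disj[of "\<lambda>s. \<not> goodX s" "\<lambda>s. \<not> goodY s"]
      ok gX gY by linarith
  have tY: "?n (\<lambda>s. \<not> cp S (Y \<otimes> A1) s (\<lambda>r. \<not> good r) \<le> 1 / 16) \<le> 16 * (32 * (d * N) + 33 * (e * N))"
    using cp_markov[OF fin, of "1 / 16" "Y \<otimes> A1" "\<lambda>r. \<not> good r"] g by (simp add: not_le)
  have tZ: "?n (\<lambda>s. \<not> cp S (Z \<otimes> A1) s (\<lambda>r. \<not> good r) \<le> 1 / 16) \<le> 16 * (32 * (d * N) + 33 * (e * N))"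
    using cp_markov[OF fin, of "1 / 16" "Z \<otimes> A1" "\<lambda>r. \<not> good r"] g by (simp add: not_le)
  have tB: "?n (\<lambda>s. \<not> (\<forall>t\<in>S. Z t = Z s \<and> A1 t = A1 s \<longrightarrow> B2 t = B2 s)) \<le> e * N"
    using amb by simp
  define P1 where "P1 s \<longleftrightarrow> \<not> good s" for s
  define P2 where "P2 s \<longleftrightarrow> \<not> cp S (Y \<otimes> A1) s (\<lambda>r. \<not> good r) \<le> 1 / 16" for s
  define P3 where "P3 s \<longleftrightarrow> \<not> cp S (Z \<otimes> A1) s (\<lambda>r. \<not> good r) \<le> 1 / 16" for s
  define P4 where "P4 s \<longleftrightarrow> \<not> close S A Y A1 (1 / 16) s" for s
  define P5 where "P5 s \<longleftrightarrow> \<not> close S A Z A1 (1 / 16) s" for s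
  define P6 where "P6 s \<longleftrightarrow> \<not> (\<forall>t\<in>S. Z t = Z s \<and> A1 t = A1 s \<longrightarrow> B2 t = B2 s)" for s
  have "?n (\<lambda>s. \<not> typical s) = ?n (\<lambda>s. P1 s \<or> (P2 s \<or> (P3 s \<or> (P4 s \<or> (P5 s \<or> P6 s)))))"
    by (simp add: typical_def P1_def P2_def P3_def P4_def P5_def P6_def)
  also have "\<dots> \<le> ?n P1 + (?n P2 + (?n P3 + (?n P4 + (?n P5 + ?n P6))))"
    by (intro order_trans[OF disj] add_left_mono order_refl)
  also have "\<dots> \<le> 1088 * (d * N) + 1090 * (e * N)"
  proof -
    have "?n P1 \<le> 32 * (d * N) + 33 * (e * N)" unfolding P1_def by (rule g)
    moreover have "?n P2 \<le> 16 * (32 * (d * N) + 33 * (e * N))" unfolding P2_def by (rule tY)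
    moreover have "?n P3 \<le> 16 * (32 * (d * N) + 33 * (e * N))" unfolding P3_def by (rule tZ)
    moreover have "?n P4 \<le> 16 * (d * N)" unfolding P4_def by (rule clAY)
    moreover have "?n P5 \<le> 16 * (d * N)" unfolding P5_def by (rule clAZ)
    moreover have "?n P6 \<le> e * N" unfolding P6_def by (rule tB)
    moreover have "a1 + (a2 + (a3 + (a4 + (a5 + a6)))) \<le> 1088 * x + 1090 * y"
      if "a1 \<le> 32 * x + 33 * y" "a2 \<le> 16 * (32 * x + 33 * y)" "a3 \<le> 16 * (32 * x + 33 * y)"
        "a4 \<le> 16 * x" "a5 \<le> 16 * x" "a6 \<le> y" for a1 a2 a3 a4 a5 a6 x y :: real
      using that by (simp add: distrib_left)
    ultimately show ?thesis by blast
  qed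
  also have "\<dots> \<le> 1100 * (d * N) + 1100 * (e * N)"
    using N0 d ok(2) by (intro add_mono mult_right_mono mult_nonneg_nonneg) auto
  finally show ?thesis by (simp add: algebra_simps)
qed

end

section \<open>Every large comparable set has an efficient partition\<close>

text \<open>\<open>ambiguous_block_bound\<close> with the deficit \<open>5 * ln 2\<close> of
  \<open>tight_pair\<close>. For scales at least \<open>w\<close> apart, at most a fraction
  \<open>6 / w\<close> of the points is ambiguous.\<close>

lemma tight_ambiguous:
  assumes tg: "tight L c S X Y Z" and q: "q \<le> L"
  shows "real (card {s \<in> S. \<exists>t\<in>S. X t = X s \<and> block S Y q t = block S Y q s \<and> block S Z l t \<noteq> block S Z l s})
     * (real q - real l) \<le> 6 * real (card S)"
proof -
  have fin: "finite S" and ne: "S \<noteq> {}" and cmp: "comparable S X Y Z"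
    using tg by (auto simp: tight_def)
  have N: "real (card S) > 0" using fin ne by (simp add: card_gt_0_iff)
  let ?k = "real (card {s \<in> S. \<exists>t\<in>S. X t = X s \<and> block S Y q t = block S Y q s \<and> block S Z l t \<noteq> block S Z l s})"
  have "?k / real (card S) * (ln (real (2 ^ q)) - ln (real (2 ^ l))) \<le> 5 * ln 2 + ln 2"
  proof (rule ambiguous_block_bound[OF fin ne])
    fix s t assume st: "s \<in> S" "t \<in> S" "X s = X t" "block S Y q s < block S Y q t"
    then have "Y s < Y t" using block_less[OF fin] by blast
    then have "Z s < Z t" using comparable_less[OF cmp st(1-3)] by blast
    then show "block S Z l s \<le> block S Z l t" by (intro block_mono[OF fin]) simp
  next
    show "ln (real (2 ^ q)) - 5 * ln 2 \<le> cent S (block S Y q) X"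
      using tight_pair(1)[OF tg q] by (simp add: ln_2_pow algebra_simps)
  qed (use block_lt[OF fin] in auto)
  then have "?k / real (card S) * ((real q - real l) * ln 2) \<le> 6 * ln 2"
    by (simp add: ln_2_pow algebra_simps)
  then have "(?k / real (card S) * (real q - real l)) * ln 2 \<le> 6 * ln 2"
    by (simp only: mult.assoc)
  then have "?k / real (card S) * (real q - real l) \<le> 6"
    by (subst (asm) mult_le_cancel_right_pos) auto
  then show ?thesis using N by (simp add: field_simps)
qed

lemma card_image_le_if_determined:
  assumes "finite (f ` R)" "\<And>s t. s \<in> R \<Longrightarrow> t \<in> R \<Longrightarrow> f s = f t \<Longrightarrow> g s = g t"
  shows "card (g ` R) \<le> card (f ` R)"
proof -
  have "g ` R = (\<lambda>v. g (SOME s. s \<in> R \<and> f s = v)) ` f ` R"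
    unfolding image_image
  proof (intro image_cong refl)
    fix s assume s: "s \<in> R"
    then have "(SOME t. t \<in> R \<and> f t = f s) \<in> R \<and> f (SOME t. t \<in> R \<and> f t = f s) = f s"
      by (intro someI[of "\<lambda>t. t \<in> R \<and> f t = f s" s]) auto
    then show "g s = g (SOME t. t \<in> R \<and> f t = f s)"
      using assms(2)[of "SOME t. t \<in> R \<and> f t = f s" s] s by simp
  qed
  then show ?thesis using card_image_le[OF assms(1)] by metis
qed

text \<open>Two nested pigeonhole arguments over \<open>K\<close> windows select the scales for
  \<open>squeeze\<close>. A large \<open>w\<close> makes ambiguous points rare, a large
  \<open>K\<close> makes the increments over a window small.\<close>

lemma not_tight:
  fixes w K :: nat
  assumes w: "10 ^ 6 \<le> real w" and K: "3 * 10 ^ 9 \<le> real K" and L: "L = K * (K * (3 * w))"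
  shows "\<not> tight L c S X Y Z"
proof
  assume tg: "tight L c S X Y Z"
  have fin: "finite S" and ne: "S \<noteq> {}" and cmp: "comparable S X Y Z"
    using tg by (auto simp: tight_def)
  have YXZ: "tight L c S Y X Z" by (rule tight_swap12[OF tg])
  have ZXY: "tight L c S Z X Y" by (rule tight_swap12[OF tight_swap23[OF tg]])
  have YZX: "tight L c S Y Z X" by (rule tight_swap23[OF tight_swap12[OF tg]])
  define N where "N = real (card S)"
  have N: "N > 0" using fin ne by (simp add: N_def card_gt_0_iff)
  \<comment> \<open>Small enough for \<open>1100 * e + 1100 * d \<le> 1 / 2\<close> below; the bound
    on \<open>K\<close> comes from \<open>15 / (3 * 10 ^ 9) = d\<^sup>2 / 2\<close>.\<close>
  define d :: real where "d = 1 / 10 ^ 4"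
  define D where "D = K * (3 * w)"
  have K0: "K > 0" using K by (cases K) auto
  have ln2: "ln 2 \<le> (1::real)" using ln_le_minus_one[of "2::real"] by simp
  have inc: "15 * ln 2 / real K \<le> d\<^sup>2 / 2"
  proof -
    have "15 * ln 2 / real K \<le> 15 * 1 / (3 * 10 ^ 9)"
      using K K0 ln2 by (intro frac_le) auto
    also have "\<dots> = d\<^sup>2 / 2" by (simp add: d_def power2_eq_square)
    finally show ?thesis .
  qed
  \<comment> \<open>Each summand grows with the scale and is at most \<open>5 * ln 2\<close>, so
    some window of length \<open>D\<close> adds little to all three.\<close>
  define \<Phi> where "\<Phi> i = minfo S (block S Y i) X + minfo S (block S X i) Y + minfo S (block S X i) Z" for i
  obtain k where k: "k < K" "\<Phi> (Suc k * D) - \<Phi> (k * D) \<le> (\<Phi> (K * D) - \<Phi> (0 * D)) / real K"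
    using small_increment[OF K0, of "\<lambda>k. \<Phi> (k * D)"] by auto
  define p0 where "p0 = k * D"
  define L1 where "L1 = Suc k * D"
  have L1L: "L1 \<le> L" using k(1) unfolding L1_def L D_def[symmetric] by (intro mult_right_mono) auto
  have "\<Phi> (K * D) \<le> 15 * ln 2"
    using minfo_block_le[OF tg, of "K * D"] minfo_block_le[OF YXZ, of "K * D"] minfo_block_le[OF ZXY, of "K * D"]
    by (simp add: \<Phi>_def L D_def)
  moreover have "\<Phi> (0 * D) \<ge> 0" unfolding \<Phi>_def using minfo_nonneg[OF fin] by (intro add_nonneg_nonneg)
  ultimately have "(\<Phi> (K * D) - \<Phi> (0 * D)) / real K \<le> 15 * ln 2 / real K"
    by (intro divide_right_mono) auto
  with k(2) inc have \<Phi>inc: "\<Phi> L1 - \<Phi> p0 \<le> d\<^sup>2 / 2" by (simp add: L1_def p0_def)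
  \<comment> \<open>The blocks of \<open>X\<close> and \<open>Y\<close> at the end of the window
    leave at most \<open>8 * ln 2\<close> of uncertainty about the block of \<open>Z\<close>, so
    some subwindow of length \<open>3 * w\<close> adds little.\<close>
  define \<kappa> where "\<kappa> l = cent S (block S Z l) (block S X L1 \<otimes> block S Y L1)" for l
  obtain m where m: "m < K" "\<kappa> (p0 + Suc m * (3 * w)) - \<kappa> (p0 + m * (3 * w))
      \<le> (\<kappa> (p0 + K * (3 * w)) - \<kappa> (p0 + 0 * (3 * w))) / real K"
    using small_increment[OF K0, of "\<lambda>m. \<kappa> (p0 + m * (3 * w))"] by auto
  \<comment> \<open>The scales \<open>l0\<close>, \<open>p2\<close>, \<open>p\<close>,
    \<open>l1\<close>, spaced by \<open>w\<close>, carry \<open>C0\<close>, \<open>B2\<close>,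
    \<open>A1\<close>, \<open>C\<close> in this order. The first two gaps make ambiguity rare; the
    last one gives the contradiction.\<close>
  define l0 where "l0 = p0 + m * (3 * w)"
  define p2 where "p2 = l0 + w"
  define p where "p = l0 + 2 * w"
  define l1 where "l1 = l0 + 3 * w"
  have l1L1: "l1 \<le> L1"
  proof -
    have "Suc m * (3 * w) \<le> K * (3 * w)" using m(1) by (intro mult_right_mono) auto
    then show ?thesis by (simp add: l1_def l0_def L1_def p0_def D_def)
  qed
  have ord: "p0 \<le> p2" "p0 \<le> p" "p2 \<le> L1" "p \<le> L1" "l0 \<le> l1" "l0 \<le> L1" "p0 \<le> L1"
    using l1L1 by (auto simp: l1_def p_def p2_def l0_def)
  define A where "A = block S X L1"
  define B where "B = block S Y L1"
  define A1 where "A1 = block S X p"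
  define B2 where "B2 = block S Y p2"
  define C where "C = block S Z l1"
  define C0 where "C0 = block S Z l0"
  have "p0 + K * (3 * w) = L1" by (simp add: p0_def L1_def D_def)
  then have "\<kappa> (p0 + K * (3 * w)) \<le> 8 * ln 2"
    using tight_triple[OF tg L1L] by (simp add: \<kappa>_def)
  moreover have "\<kappa> (p0 + 0 * (3 * w)) \<ge> 0" unfolding \<kappa>_def by (rule cent_nonneg[OF fin])
  moreover have "(8::real) * ln 2 \<le> 15 * ln 2" by simp
  ultimately have "(\<kappa> (p0 + K * (3 * w)) - \<kappa> (p0 + 0 * (3 * w))) / real K \<le> 15 * ln 2 / real K"
    by (intro divide_right_mono) linarith+
  moreover have "p0 + Suc m * (3 * w) = l1" by (simp add: l1_def l0_def)
  ultimately have \<kappa>inc: "\<kappa> l1 - \<kappa> l0 \<le> d\<^sup>2 / 2" using m(2) inc by (simp add: l0_def)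
  have detX: "determines S A A1" unfolding A_def A1_def by (rule determines_block_block[OF ord(4)])
  have detY: "determines S B B2" unfolding B_def B2_def by (rule determines_block_block[OF ord(3)])
  have detZ: "determines S C C0" unfolding C_def C0_def by (rule determines_block_block[OF ord(5)])
  have mono1: "minfo S (block S Y p0) X \<le> minfo S B X" "minfo S (block S X p0) Y \<le> minfo S A Y"
      "minfo S (block S X p0) Z \<le> minfo S A Z"
    unfolding A_def B_def by (intro minfo_mono[OF fin] determines_block_block ord(7))+
  have mono2: "minfo S (block S Y p0) X \<le> minfo S B2 X" "minfo S (block S X p0) Y \<le> minfo S A1 Y"
      "minfo S (block S X p0) Z \<le> minfo S A1 Z"
    unfolding A1_def B2_def by (intro minfo_mono[OF fin] determines_block_block ord(1,2))+
  have iX: "minfo S B X - minfo S B2 X \<le> d\<^sup>2 / 2" and iY: "minfo S A Y - minfo S A1 Y \<le> d\<^sup>2 / 2"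
    and iZ: "minfo S A Z - minfo S A1 Z \<le> d\<^sup>2 / 2"
    using \<Phi>inc mono1 mono2 unfolding \<Phi>_def A_def[symmetric] B_def[symmetric] by linarith+
  \<comment> \<open>An arbitrary choice makes \<open>G\<close> an exact function of \<open>X\<close>
    and \<open>B2\<close>, which can differ from \<open>C0\<close> only at ambiguous points.\<close>
  define G where "G s = C0 (SOME t. t \<in> S \<and> X t = X s \<and> B2 t = B2 s)" for s
  define G' where "G' s = C0 (SOME t. t \<in> S \<and> Y t = Y s \<and> A1 t = A1 s)" for s
  have Gdet: "G s = G t" if "X s = X t" "B2 s = B2 t" for s t
    using that by (simp add: G_def)
  have G'det: "G' s = G' t" if "Y s = Y t" "A1 s = A1 t" for s t
    using that by (simp add: G'_def)
  have Gne: "\<exists>t\<in>S. X t = X s \<and> B2 t = B2 s \<and> C0 t \<noteq> C0 s" if "s \<in> S" "G s \<noteq> C0 s" for s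
    using someI[of "\<lambda>t. t \<in> S \<and> X t = X s \<and> B2 t = B2 s" s] that unfolding G_def by blast
  have G'ne: "\<exists>t\<in>S. Y t = Y s \<and> A1 t = A1 s \<and> C0 t \<noteq> C0 s" if "s \<in> S" "G' s \<noteq> C0 s" for s
    using someI[of "\<lambda>t. t \<in> S \<and> Y t = Y s \<and> A1 t = A1 s" s] that unfolding G'_def by blast
  let ?n = "\<lambda>P. real (card {s \<in> S. P s})"
  have w0: "real w > 0" using w by simp
  have small: "x \<le> 6 / 10 ^ 6 * N" if "x * y \<le> 6 * real (card S)" "y \<ge> real w" "x \<ge> 0" for x y :: real
  proof -
    have "x * 10 ^ 6 \<le> x * y" using that w by (intro mult_left_mono) auto
    then show ?thesis using that by (simp add: N_def)
  qed
  have nG: "?n (\<lambda>s. \<exists>t\<in>S. X t = X s \<and> B2 t = B2 s \<and> C0 t \<noteq> C0 s) \<le> 6 / 10 ^ 6 * N"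
    unfolding B2_def C0_def
    by (rule small[OF tight_ambiguous[OF tg]]) (use ord L1L in \<open>auto simp: p2_def\<close>)
  have nG': "?n (\<lambda>s. \<exists>t\<in>S. Y t = Y s \<and> A1 t = A1 s \<and> C0 t \<noteq> C0 s) \<le> 6 / 10 ^ 6 * N"
    unfolding A1_def C0_def
    by (rule small[OF tight_ambiguous[OF YXZ]]) (use ord L1L in \<open>auto simp: p_def\<close>)
  have nB: "?n (\<lambda>s. \<exists>t\<in>S. Z t = Z s \<and> A1 t = A1 s \<and> B2 t \<noteq> B2 s) \<le> 6 / 10 ^ 6 * N"
    unfolding A1_def B2_def
    by (rule small[OF tight_ambiguous[OF ZXY]]) (use ord L1L in \<open>auto simp: p_def p2_def\<close>)
  obtain F0 where F0: "?n (\<lambda>s. C s \<noteq> F0 ((C0 \<otimes> (A \<otimes> B)) s)) \<le> cent S C (C0 \<otimes> (A \<otimes> B)) * real (card S)"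
    using guess_of_small_cent[OF fin, of C "C0 \<otimes> (A \<otimes> B)"] by blast
  \<comment> \<open>As \<open>C\<close> determines \<open>C0\<close>, the uncertainty of the guess
    is exactly an increment of \<open>\<kappa>\<close>.\<close>
  have "ent S (C \<otimes> (C0 \<otimes> (A \<otimes> B))) = ent S (C \<otimes> (A \<otimes> B))"
    using detZ by (intro ent_cong[OF fin]) (unfold determines_def, blast+)
  then have "cent S C (C0 \<otimes> (A \<otimes> B)) = \<kappa> l1 - \<kappa> l0"
    by (simp add: cent_def \<kappa>_def C_def C0_def A_def B_def)
  then have "cent S C (C0 \<otimes> (A \<otimes> B)) * real (card S) \<le> d\<^sup>2 / 2 * N"
    using \<kappa>inc N unfolding N_def[symmetric] by (simp add: mult_right_mono)
  with F0 have nF: "?n (\<lambda>s. C s \<noteq> F0 (C0 s, A s, B s)) \<le> d\<^sup>2 / 2 * N" by simp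
  define F where "F a b c0 = F0 (c0, a, b)" for a b c0
  interpret squeeze S X Y Z A B A1 B2 C C0 G G' F
  proof
    show "finite S" "S \<noteq> {}" by (fact fin ne)+
    fix s t assume st: "s \<in> S" "t \<in> S"
    show "B s \<le> B t" if "Z s = Z t" "A s < A t"
    proof -
      have "X s < X t" using that(2) block_less[OF fin] unfolding A_def by blast
      then have "Y s < Y t"
        using comparable_less[OF comparable_swap12[OF comparable_swap23[OF cmp]] st that(1)] by blast
      then show ?thesis unfolding B_def by (intro block_mono[OF fin]) simp
    qed
    show "C s \<le> C t" if "Y s = Y t" "A s < A t"
    proof -
      have "X s < X t" using that(2) block_less[OF fin] unfolding A_def by blast
      then have "Z s < Z t" using comparable_less[OF comparable_swap12[OF cmp] st that(1)] by blast
      then show ?thesis unfolding C_def by (intro block_mono[OF fin]) simp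
    qed
    show "C s \<le> C t" if "X s = X t" "B s < B t"
    proof -
      have "Y s < Y t" using that(2) block_less[OF fin] unfolding B_def by blast
      then have "Z s < Z t" using comparable_less[OF cmp st that(1)] by blast
      then show ?thesis unfolding C_def by (intro block_mono[OF fin]) simp
    qed
    show "G' s = G' t" if "Y s = Y t" "A1 s = A1 t" by (rule G'det[OF that])
  next
    fix s t
    show "A1 s = A1 t" if "A s = A t" using that unfolding A_def A1_def by (rule block_eq_coarser[OF ord(4)])
    show "B2 s = B2 t" if "B s = B t" using that unfolding B_def B2_def by (rule block_eq_coarser[OF ord(3)])
    show "B s = B t" if "Y s = Y t" using that unfolding B_def by (rule block_determined)
    show "C s = C t" if "Z s = Z t" using that unfolding C_def by (rule block_determined)
    show "C0 s = C0 t" if "Z s = Z t" using that unfolding C0_def by (rule block_determined)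
  qed
  have disj: "?n (\<lambda>s. P s \<or> Q s) \<le> ?n P + ?n Q" for P Q
  proof -
    have "{s \<in> S. P s \<or> Q s} = {s \<in> S. P s} \<union> {s \<in> S. Q s}" by auto
    then have "card {s \<in> S. P s \<or> Q s} \<le> card {s \<in> S. P s} + card {s \<in> S. Q s}"
      by (simp add: card_Un_le)
    then show ?thesis by linarith
  qed
  \<comment> \<open>Failure of the guess \<open>F0\<close>, plus ambiguity for \<open>G\<close> and
    for \<open>G'\<close>.\<close>
  define e :: real where "e = d\<^sup>2 / 2 + 12 / 10 ^ 6"
  have nok: "?n (\<lambda>s. \<not> ok s) \<le> e * N"
  proof -
    define Q1 where "Q1 s \<longleftrightarrow> C s \<noteq> F0 (C0 s, A s, B s)" for s
    define Q2 where "Q2 s \<longleftrightarrow> (\<exists>t\<in>S. X t = X s \<and> B2 t = B2 s \<and> C0 t \<noteq> C0 s)" for s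
    define Q3 where "Q3 s \<longleftrightarrow> (\<exists>t\<in>S. Y t = Y s \<and> A1 t = A1 s \<and> C0 t \<noteq> C0 s)" for s
    have "{s \<in> S. \<not> ok s} \<subseteq> {s \<in> S. Q1 s \<or> (Q2 s \<or> Q3 s)}"
      using Gne G'ne unfolding ok_def F_def Q1_def Q2_def Q3_def by blast
    then have "card {s \<in> S. \<not> ok s} \<le> card {s \<in> S. Q1 s \<or> (Q2 s \<or> Q3 s)}"
      using fin by (intro card_mono) auto
    then have "?n (\<lambda>s. \<not> ok s) \<le> ?n (\<lambda>s. Q1 s \<or> (Q2 s \<or> Q3 s))" by simp
    also have "\<dots> \<le> ?n Q1 + (?n Q2 + ?n Q3)"
      by (intro order_trans[OF disj] add_left_mono order_refl)
    also have "\<dots> \<le> d\<^sup>2 / 2 * N + (6 / 10 ^ 6 * N + 6 / 10 ^ 6 * N)"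
      using nF nG nG' unfolding Q1_def Q2_def Q3_def by (intro add_mono)
    also have "\<dots> = e * N" by (simp add: e_def algebra_simps)
    finally show ?thesis .
  qed
  have e0: "0 \<le> e" by (simp add: e_def)
  have "6 / 10 ^ 6 * N \<le> e * N" using N by (intro mult_right_mono) (auto simp: e_def)
  with nB have amb: "?n (\<lambda>s. \<exists>t\<in>S. Z t = Z s \<and> A1 t = A1 s \<and> B2 t \<noteq> B2 s) \<le> e * N" by linarith
  have d0: "0 < d" by (simp add: d_def)
  have XA: "A s = A t" if "X s = X t" for s t
    using that unfolding A_def by (rule block_determined)
  have "determines S (X \<otimes> B2) (A \<otimes> G)"
    unfolding determines_def using XA Gdet by blast
  then have 1: "cent S X ((A \<otimes> G) \<otimes> B2) - cent S X (B \<otimes> ((A \<otimes> G) \<otimes> B2)) \<le> d\<^sup>2 / 2"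
    using cminfo_le_minfo_diff[OF fin detY, of X "A \<otimes> G"] iX by linarith
  have "determines S (Y \<otimes> A1) (B \<otimes> G')"
    unfolding determines_def using YB G'det by blast
  then have 2: "cent S Y ((B \<otimes> G') \<otimes> A1) - cent S Y (A \<otimes> ((B \<otimes> G') \<otimes> A1)) \<le> d\<^sup>2 / 2"
    using cminfo_le_minfo_diff[OF fin detX, of Y "B \<otimes> G'"] iY by linarith
  have 3: "cent S A A1 - cent S A (Y \<otimes> A1) \<le> d\<^sup>2 / 2"
    using minfo_diff[OF fin detX, of Y] iY by linarith
  have 4: "cent S A A1 - cent S A (Z \<otimes> A1) \<le> d\<^sup>2 / 2"
    using minfo_diff[OF fin detX, of Z] iZ by linarith
  have "?n (\<lambda>s. \<not> typical s) \<le> (1100 * e + 1100 * d) * N"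
    by (rule card_not_typical[OF N_def nok e0 amb d0 1 2 3 4])
  also have "\<dots> \<le> 1 / 2 * N"
    using N by (intro mult_right_mono) (auto simp: e_def d_def power2_eq_square)
  finally have nt: "?n (\<lambda>s. \<not> typical s) \<le> N / 2" by simp
  have "N = ?n (\<lambda>s. typical s \<or> \<not> typical s)" by (simp add: N_def)
  also have "\<dots> \<le> ?n typical + ?n (\<lambda>s. \<not> typical s)" by (rule disj)
  finally have nty: "?n typical \<ge> N / 2" using nt by linarith
  \<comment> \<open>By \<open>typical_determined\<close>, typical points with a common
    \<open>Y\<close> have one value of \<open>C\<close> per block \<open>A1\<close>, hence at most
    \<open>2 ^ p\<close> values.\<close>
  define KK where "KK y = C ` {s \<in> S. typical s \<and> Y s = y}" for y
  have KK: "finite (KK y) \<and> card (KK y) \<le> 2 ^ p" for y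
  proof -
    let ?R = "{s \<in> S. typical s \<and> Y s = y}"
    have fR: "finite (A1 ` ?R)" using fin by auto
    have "A1 ` ?R \<subseteq> {..<2 ^ p}" using block_lt[OF fin] unfolding A1_def by auto
    then have "card (A1 ` ?R) \<le> card {..<2 ^ p :: nat}" by (intro card_mono) auto
    moreover have "card (C ` ?R) \<le> card (A1 ` ?R)"
    proof (rule card_image_le_if_determined[OF fR])
      fix s t assume "s \<in> ?R" "t \<in> ?R" "A1 s = A1 t"
      then show "C s = C t" by (intro typical_determined) auto
    qed
    ultimately show ?thesis using fin unfolding KK_def by simp
  qed
  have rng: "card (C ` fib S Y s) \<le> 2 ^ l1" for s
  proof -
    have "C ` fib S Y s \<subseteq> {..<2 ^ l1}" using block_lt[OF fin] unfolding C_def by (auto simp: fib_def)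
    then have "card (C ` fib S Y s) \<le> card {..<2 ^ l1 :: nat}" by (intro card_mono) auto
    then show ?thesis by simp
  qed
  define P where "P = ?n (\<lambda>s. C s \<in> KK (Y s)) / real (card S)"
  have "card {s \<in> S. typical s} \<le> card {s \<in> S. C s \<in> KK (Y s)}"
    using fin by (intro card_mono) (auto simp: KK_def)
  then have "N / 2 \<le> ?n (\<lambda>s. C s \<in> KK (Y s))" using nty by linarith
  then have P: "P \<ge> 1 / 2" using N by (simp add: P_def N_def field_simps)
  \<comment> \<open>Given \<open>Y\<close>, \<open>C\<close> needs almost \<open>l1\<close> bits,
    but at least half of the points get by with \<open>p = l1 - w\<close> bits; the saving of
    \<open>w / 2\<close> exceeds the slack of 6.\<close>
  have "(real l1 - 5) * ln 2 \<le> cent S C Y"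
    unfolding C_def using tight_pair(1)[OF YZX] l1L1 L1L by simp
  also have "\<dots> \<le> ln 2 + P * ln (real (2 ^ p)) + (1 - P) * ln (real (2 ^ l1))"
    unfolding P_def by (rule cent_le_exceptional[OF fin ne]) (use KK rng in auto)
  also have "\<dots> = (1 + P * real p + (1 - P) * real l1) * ln 2"
    by (simp add: ln_2_pow algebra_simps)
  finally have "real l1 - 5 \<le> 1 + P * real p + (1 - P) * real l1"
    by (subst (asm) mult_le_cancel_right_pos) auto
  then have "P * (real l1 - real p) \<le> 6" by (simp add: algebra_simps)
  moreover have "real l1 - real p = real w" by (simp add: l1_def p_def)
  moreover have "1 / 2 * real w \<le> P * real w" using P w0 by (intro mult_right_mono) auto
  ultimately show False using w by simp
qed

text \<open>By \<open>no_gain_atom\<close> a fibre of a coordinate has size of order at most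
  \<open>card S powr (3 / 5)\<close>. In a large set the blocks at the fixed scale \<open>L\<close>
  are then almost equal in size, so the set would be \<open>tight\<close>.\<close>

lemma large_set_has_gain:
  obtains c M :: real where "0 < c" "c \<le> 1 / 10" "1 \<le> M"
    "\<And>(S :: 's set) X Y Z. finite S \<Longrightarrow> comparable S X Y Z \<Longrightarrow> M \<le> real (card S) \<Longrightarrow> \<not> no_gain c S X Y Z"
proof -
  obtain w :: nat where w: "10 ^ 6 \<le> real w" using real_arch_simple by blast
  obtain K :: nat where K: "3 * 10 ^ 9 \<le> real K" using real_arch_simple by blast
  define L where "L = K * (K * (3 * w))"
  define c :: real where "c = 1 / (100 * (real L + 1))"
  have L1: "L \<ge> 1"
  proof -
    have "K \<noteq> 0" "w \<noteq> 0" using K w by auto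
    then show ?thesis by (simp add: L_def)
  qed
  have c: "0 < c" "c \<le> 1 / 10" "100 * c * real L \<le> 1" by (auto simp: c_def field_simps)
  \<comment> \<open>Solves \<open>3 / 5 - 2 / 5 * ln M = - ln (40 * 2 ^ L)\<close>, so that a fibre
    has relative size at most \<open>1 / (40 * 2 ^ L)\<close>.\<close>
  define M :: real where "M = exp (5 / 2 * (3 / 5 + ln (40 * 2 ^ L)))"
  have "ln (40 * 2 ^ L :: real) \<ge> 0" by (intro ln_ge_zero) (simp add: mult_ge1_I)
  then have M1: "M \<ge> 1" by (simp add: M_def)
  have "\<not> no_gain c S X Y Z"
    if fin: "finite S" and cmp: "comparable S X Y Z" and big: "M \<le> real (card S)"
    for S :: "'s set" and X Y Z
  proof
    assume ng: "no_gain c S X Y Z"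
    define N where "N = real (card S)"
    have N: "N \<ge> M" "N > 0" using big M1 by (auto simp: N_def)
    then have ne: "S \<noteq> {}" by (auto simp: N_def)
    have lnN: "ln N \<ge> 5 / 2 * (3 / 5 + ln (40 * 2 ^ L))"
      using N M1 by (metis M_def ln_exp ln_mono exp_gt_zero)
    have entV: "(real L - 1 / 20) * ln 2 \<le> ent S (block S V L)"
      if "comparable S V V2 V3" "no_gain c S V V2 V3" for V V2 V3
    proof -
      define a where "a = nat \<lfloor>exp (3 / 5 * (1 + ln N))\<rfloor>"
      have a: "card (fib S V t) \<le> a" if t: "t \<in> S" for t
      proof -
        have p: "real (card (fib S V t)) > 0" using card_fib_pos[OF fin t, of V] by simp
        have "ln (real (card (fib S V t))) \<le> 3 / 5 * (1 + ln N)"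
          using no_gain_atom[OF fin \<open>comparable S V V2 V3\<close> \<open>no_gain c S V V2 V3\<close> c(2) t] by (simp add: N_def)
        then have "real (card (fib S V t)) \<le> exp (3 / 5 * (1 + ln N))"
          using p by (metis exp_le_cancel_iff exp_ln)
        then show ?thesis unfolding a_def by (simp add: le_nat_floor)
      qed
      have aN: "2 ^ L * (real a / N) \<le> 1 / 40"
      proof -
        have "real a \<le> exp (3 / 5 * (1 + ln N))" unfolding a_def by (simp add: of_nat_floor)
        then have "real a / N \<le> exp (3 / 5 * (1 + ln N)) / exp (ln N)"
          using N by (simp add: divide_right_mono)
        also have "\<dots> = exp (3 / 5 - 2 / 5 * ln N)" by (simp add: exp_diff[symmetric] algebra_simps)
        also have "\<dots> \<le> exp (- ln (40 * 2 ^ L))" using lnN by simp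
        also have "\<dots> = 1 / (40 * 2 ^ L)" by (simp add: exp_minus field_simps)
        finally show ?thesis by (simp add: field_simps)
      qed
      define q where "q = (1 + 2 ^ L * (real a / N)) / 2 ^ L"
      have "ent S (block S V L) \<ge> - ln q"
      proof (rule ent_ge_small_fibers[OF fin ne])
        fix s assume s: "s \<in> S"
        have "2 ^ L * card (fib S (block S V L) s) \<le> card S + 2 ^ L * a"
          by (rule block_fib_card[OF fin s a])
        then have "real (2 ^ L * card (fib S (block S V L) s)) \<le> real (card S + 2 ^ L * a)"
          by (simp only: of_nat_le_iff)
        then have "2 ^ L * real (card (fib S (block S V L) s)) \<le> N + 2 ^ L * real a"
          by (simp add: N_def)
        then show "real (card (fib S (block S V L) s)) \<le> q * real (card S)"
          using N unfolding q_def N_def[symmetric] 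
          by (simp add: pos_le_divide_eq mult.commute distrib_left)
      qed
      \<comment> \<open>Since \<open>ln 2 \<ge> 1 / 2\<close>, the loss \<open>1 / 40\<close> fits
        into the slack \<open>ln 2 / 20\<close> of \<open>tight\<close>.\<close>
      moreover have "ln q \<le> 1 / 40 - real L * ln 2"
      proof -
        have t0: "2 ^ L * (real a / N) \<ge> 0" using N by simp
        have "ln q = ln (1 + 2 ^ L * (real a / N)) - real L * ln 2"
          unfolding q_def using t0 by (subst ln_div) (auto simp: ln_2_pow add_nonneg_pos)
        also have "ln (1 + 2 ^ L * (real a / N)) \<le> 2 ^ L * (real a / N)"
          by (rule ln_add_one_self_le_self[OF t0])
        finally show ?thesis using aN by linarith
      qed
      moreover have "ln 2 \<ge> (1 / 2 :: real)"
        using ln_le_minus_one[of "1 / 2 :: real"] by (simp add: ln_div)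
      ultimately show ?thesis by (simp add: algebra_simps)
    qed
    have "tight L c S X Y Z"
      unfolding tight_def using fin ne cmp ng c
        entV[OF cmp ng] entV[OF comparable_swap12[OF cmp] no_gain_swap12[OF ng]]
        entV[OF comparable_swap12[OF comparable_swap23[OF cmp]] no_gain_swap12[OF no_gain_swap23[OF ng]]]
      by auto
    then show False using not_tight[OF w K L_def] by blast
  qed
  then show ?thesis using that c M1 by blast
qed

section \<open>Induction from the parts to the whole set\<close>

lemma sum_ent_fib:
  assumes fin: "finite S"
  shows "(\<Sum>s\<in>S. ent (fib S T s) V) = real (card S) * cent S V T"
proof -
  let ?\<phi> = "\<lambda>t. ln (real (card (fib S T t)) / real (card (fib S (V \<otimes> T) t)))"
  have "ent (fib S T s) V = avg S T ?\<phi> s" for s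
  proof -
    have "fib (fib S T s) V t = fib S (V \<otimes> T) t" "fib S T t = fib S T s" if "t \<in> fib S T s" for t
      using that by (auto simp: fib_def)
    then show ?thesis unfolding ent_def avg_def
      by (intro arg_cong2[where f = "(/)"] sum.cong refl) simp
  qed
  then have "(\<Sum>s\<in>S. ent (fib S T s) V) = (\<Sum>s\<in>S. avg S T ?\<phi> s)" by simp
  also have "\<dots> = (\<Sum>s\<in>S. ?\<phi> s)" by (rule sum_avg[OF fin])
  finally show ?thesis by (cases "S = {}") (auto simp: cent_eq[OF fin] fin)
qed

text \<open>Averaging the bound over the parts loses \<open>(3 / 2 + c) * ent S T\<close> on the
  left. Rewriting each \<open>cent S V T\<close> by the chain rule loses \<open>3 * ent S T\<close>
  on the right and adds less than \<open>(3 / 2 - c) * ent S T\<close>. The losses balance, so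
  \<open>ln M\<close> is paid only once.\<close>

lemma sum_ent_ge:
  fixes c M :: real
  assumes c: "0 < c" "c \<le> 1 / 10" and M: "1 \<le> M"
    and gain: "\<And>(S :: 's set). finite S \<Longrightarrow> comparable S X Y Z \<Longrightarrow> M \<le> real (card S) \<Longrightarrow> \<not> no_gain c S X Y Z"
    and "finite S" "S \<noteq> {}" "comparable S X Y Z"
  shows "(3 / 2 + c) * (ln (real (card S)) - ln M) \<le> ent S X + ent S Y + ent S Z"
  using assms(5-7)
proof (induction "card S" arbitrary: S rule: less_induct)
  case less
  note fin = less.prems(1) and ne = less.prems(2) and cmp = less.prems(3)
  define N where "N = real (card S)"
  have N: "N > 0" using fin ne by (simp add: N_def card_gt_0_iff)
  show ?case
  proof (cases "N < M")
    case True
    then have "ln N \<le> ln M" using N by simp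
    then have "(3 / 2 + c) * (ln N - ln M) \<le> 0" using c by (intro mult_nonneg_nonpos) auto
    also have "\<dots> \<le> ent S X + ent S Y + ent S Z" using ent_nonneg[OF fin] by (intro add_nonneg_nonneg)
    finally show ?thesis by (simp add: N_def)
  next
    case False
    then obtain T :: "'s \<Rightarrow> 's set" where
      T: "cent S T X + cent S T Y + cent S T Z < (3 / 2 - c) * ent S T"
      using gain[OF fin cmp] unfolding no_gain_def N_def not_less not_le not_all by blast
    have "0 \<le> cent S T X + cent S T Y + cent S T Z"
      using cent_nonneg[OF fin] by (intro add_nonneg_nonneg)
    with T have "(3 / 2 - c) * ent S T > 0" by linarith
    then have Tpos: "ent S T > 0" using c by (simp add: zero_less_mult_iff)
    \<comment> \<open>Positive entropy excludes the trivial partition, so every part is a proper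
      subset.\<close>
    have lt: "card (fib S T s) < card S" if s: "s \<in> S" for s
    proof (rule psubset_card_mono[OF fin])
      have "fib S T s \<noteq> S"
      proof
        assume "fib S T s = S"
        then have "\<forall>t\<in>S. T t = T s" by (auto simp: fib_def)
        then have "ent S T = ent S (\<lambda>_. ())"
          by (intro ent_cong[OF fin]) (auto simp: determines_def)
        then show False using Tpos ent_const[OF fin, of "()"] by simp
      qed
      then show "fib S T s \<subset> S" using fib_subset[of S T s] by blast
    qed
    have IH: "(3 / 2 + c) * (ln (real (card (fib S T s))) - ln M)
        \<le> ent (fib S T s) X + ent (fib S T s) Y + ent (fib S T s) Z" if s: "s \<in> S" for s
      using less.hyps[OF lt[OF s]] fin s comparable_subset[OF cmp fib_subset, of T s]
        card_fib_pos[OF fin s, of T] by (auto simp: card_gt_0_iff)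
    have "(\<Sum>s\<in>S. (3 / 2 + c) * (ln (real (card (fib S T s))) - ln M))
        \<le> (\<Sum>s\<in>S. ent (fib S T s) X + ent (fib S T s) Y + ent (fib S T s) Z)"
      by (intro sum_mono IH)
    also have "\<dots> = N * (cent S X T + cent S Y T + cent S Z T)"
      by (simp add: sum.distrib sum_ent_fib[OF fin] N_def distrib_left)
    also have "(\<Sum>s\<in>S. (3 / 2 + c) * (ln (real (card (fib S T s))) - ln M))
        = (3 / 2 + c) * ((\<Sum>s\<in>S. ln (real (card (fib S T s)))) - N * ln M)"
      by (simp add: sum_distrib_left[symmetric] sum_subtractf N_def)
    also have "(\<Sum>s\<in>S. ln (real (card (fib S T s)))) = N * (ln N - ent S T)"
    proof -
      have "(\<Sum>s\<in>S. ln (N / real (card (fib S T s)))) = (\<Sum>s\<in>S. ln N - ln (real (card (fib S T s))))"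
      proof (intro sum.cong refl)
        fix s assume "s \<in> S"
        then show "ln (N / real (card (fib S T s))) = ln N - ln (real (card (fib S T s)))"
          using card_fib_pos[OF fin, of s T] N by (simp add: ln_div)
      qed
      also have "\<dots> = N * ln N - (\<Sum>s\<in>S. ln (real (card (fib S T s))))"
        by (simp add: sum_subtractf N_def)
      finally have "N * ent S T = N * ln N - (\<Sum>s\<in>S. ln (real (card (fib S T s))))"
        using N by (simp add: ent_def N_def[symmetric])
      then show ?thesis by (simp add: right_diff_distrib)
    qed
    also have "(3 / 2 + c) * (N * (ln N - ent S T) - N * ln M) = N * ((3 / 2 + c) * (ln N - ent S T - ln M))"
      by (simp add: algebra_simps)
    finally have "N * ((3 / 2 + c) * (ln N - ent S T - ln M)) \<le> N * (cent S X T + cent S Y T + cent S Z T)" .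
    then have main: "(3 / 2 + c) * (ln N - ent S T - ln M) \<le> cent S X T + cent S Y T + cent S Z T"
      using N by simp
    have sw: "cent S V T = ent S V + cent S T V - ent S T" for V :: "'s \<Rightarrow> int"
      using ent_cong[OF fin, of "V \<otimes> T" "T \<otimes> V"] by (simp add: cent_def determines_def)
    have "(3 / 2 + c) * (ln N - ent S T - ln M) \<le> ent S X + ent S Y + ent S Z
        + (cent S T X + cent S T Y + cent S T Z) - 3 * ent S T"
      using main by (simp add: sw)
    moreover have "(3 / 2 + c) * (ln N - ent S T - ln M) = (3 / 2 + c) * (ln N - ln M) - 3 / 2 * ent S T - c * ent S T"
      "(3 / 2 - c) * ent S T = 3 / 2 * ent S T - c * ent S T"
      by (simp_all add: algebra_simps add_divide_distrib diff_divide_distrib)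
    ultimately show ?thesis using T unfolding N_def[symmetric] by linarith
  qed
qed

section \<open>The power saving\<close>

lemma two_less_cases:
  assumes "two_less a b"
  shows "a $ 1 < b $ 1 \<and> a $ 2 < b $ 2 \<or> a $ 1 < b $ 1 \<and> a $ 3 < b $ 3 \<or> a $ 2 < b $ 2 \<and> a $ 3 < b $ 3"
proof (rule ccontr)
  assume *: "\<not> ?thesis"
  have "i = j" if "a $ i < b $ i" "a $ j < b $ j" for i j
    using that * exhaust_3[of i] exhaust_3[of j] by auto
  then have "card {i. a $ i < b $ i} \<le> 1" using card_le_Suc0_iff_eq[of "{i. a $ i < b $ i}"] by simp
  then show False using assms by (simp add: two_less_def)
qed

lemma two_increasing_distinct_comparable:
  assumes "two_increasing as"
  shows "distinct as" "comparable (set as) (\<lambda>a. a $ 1) (\<lambda>a. a $ 2) (\<lambda>a. a $ 3)"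
proof -
  have irr: "\<not> two_less a a" for a by (simp add: two_less_def)
  show "distinct as"
    unfolding distinct_conv_nth
  proof (intro allI impI)
    fix i j assume "i < length as" "j < length as" "i \<noteq> j"
    then show "as ! i \<noteq> as ! j"
      using assms irr[of "as ! i"] unfolding two_increasing_def by (metis linorder_neq_iff)
  qed
  have lt: "two_less s t \<or> two_less t s" if "s \<in> set as" "t \<in> set as" "s \<noteq> t" for s t
    using that assms unfolding two_increasing_def in_set_conv_nth by (metis linorder_neq_iff)
  show "comparable (set as) (\<lambda>a. a $ 1) (\<lambda>a. a $ 2) (\<lambda>a. a $ 3)"
    unfolding comparable_def
  proof (intro ballI impI)
    fix s t assume st: "s \<in> set as" "t \<in> set as" "s \<noteq> t"
    show "(s $ 1 = t $ 1 \<longrightarrow> s $ 2 < t $ 2 \<and> s $ 3 < t $ 3 \<or> t $ 2 < s $ 2 \<and> t $ 3 < s $ 3) \<and>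
       (s $ 2 = t $ 2 \<longrightarrow> s $ 1 < t $ 1 \<and> s $ 3 < t $ 3 \<or> t $ 1 < s $ 1 \<and> t $ 3 < s $ 3) \<and>
       (s $ 3 = t $ 3 \<longrightarrow> s $ 1 < t $ 1 \<and> s $ 2 < t $ 2 \<or> t $ 1 < s $ 1 \<and> t $ 2 < s $ 2)"
      using lt[OF st]
    proof
      assume "two_less s t"
      then show ?thesis using two_less_cases[of s t] by auto
    next
      assume "two_less t s"
      then show ?thesis using two_less_cases[of t s] by auto
    qed
  qed
qed

text \<open>If all pairs \<open>(x, y)\<close> occur, then \<open>z \<ge> y\<close> along the row \<open>x = 1\<close>, so there is no room
  above the entry \<open>z = n\<close> at \<open>(1, n)\<close>.\<close>
lemma comparable_card_less_square:
  fixes n :: nat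
  assumes fin: "finite S" and cmp: "comparable S X Y Z" and n: "2 \<le> n"
    and rng: "\<And>s. s \<in> S \<Longrightarrow> X s \<in> {1..int n} \<and> Y s \<in> {1..int n} \<and> Z s \<in> {1..int n}"
  shows "card S < n\<^sup>2"
proof -
  let ?Q = "{1..int n} \<times> {1..int n}"
  have inj: "inj_on (X \<otimes> Y) S"
    using comparable_inj[OF cmp] by (auto intro!: inj_onI)
  have sub: "(X \<otimes> Y) ` S \<subseteq> ?Q" using rng by auto
  have cQ: "card ?Q = n\<^sup>2" by (simp add: card_cartesian_product power2_eq_square)
  have "(X \<otimes> Y) ` S \<noteq> ?Q"
  proof
    assume full: "(X \<otimes> Y) ` S = ?Q"
    have ex: "\<exists>s\<in>S. X s = x \<and> Y s = y" if "x \<in> {1..int n}" "y \<in> {1..int n}" for x y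
    proof -
      have "(x, y) \<in> (X \<otimes> Y) ` S" using that full by auto
      then show ?thesis by auto
    qed
    have row: "int k \<le> Z s" if "1 \<le> k" "k \<le> n" "s \<in> S" "X s = 1" "Y s = int k" for k s
      using that
    proof (induction k arbitrary: s rule: dec_induct)
      case base
      then show ?case using rng[of s] by simp
    next
      case (step k)
      obtain t where t: "t \<in> S" "X t = 1" "Y t = int k" using ex[of 1 "int k"] step by auto
      then have "int k \<le> Z t" using step by simp
      moreover have "Z t < Z s" using comparable_less[OF cmp t(1) step.prems(2)] t step.prems by simp
      ultimately show ?case by simp
    qed
    obtain s where s: "s \<in> S" "X s = 1" "Y s = int n" using ex[of 1 "int n"] n by auto
    obtain t where t: "t \<in> S" "X t = 2" "Y t = int n" using ex[of 2 "int n"] n by auto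
    have "int n \<le> Z s" using row[of n s] s n by simp
    moreover have "Z s < Z t" using comparable_less[OF comparable_swap12[OF cmp] s(1) t(1)] s t by simp
    ultimately show False using rng[OF t(1)] by simp
  qed
  with sub have "(X \<otimes> Y) ` S \<subset> ?Q" by blast
  then have "card ((X \<otimes> Y) ` S) < card ?Q" by (intro psubset_card_mono) auto
  then show ?thesis using card_image[OF inj] cQ by simp
qed

lemma comparable_card_bound:
  obtains \<epsilon> M :: real where "0 < \<epsilon>" "1 \<le> M"
    "\<And>(S :: 's set) X Y Z n. finite S \<Longrightarrow> S \<noteq> {} \<Longrightarrow> comparable S X Y Z \<Longrightarrow>
       (\<And>s. s \<in> S \<Longrightarrow> X s \<in> {1..int n} \<and> Y s \<in> {1..int n} \<and> Z s \<in> {1..int n}) \<Longrightarrow>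
       ln (real (card S)) \<le> ln M + (2 - \<epsilon>) * ln (real n)"
proof -
  obtain c M :: real where c: "0 < c" "c \<le> 1 / 10" and M: "1 \<le> M"
    and gain: "\<And>(S :: 's set) X Y Z. finite S \<Longrightarrow> comparable S X Y Z \<Longrightarrow> M \<le> real (card S) \<Longrightarrow> \<not> no_gain c S X Y Z"
    using large_set_has_gain by blast
  \<comment> \<open>Each coordinate has entropy at most \<open>ln n\<close>, which leads to the
    exponent \<open>3 / (3 / 2 + c) < 2\<close>.\<close>
  define \<epsilon> where "\<epsilon> = 2 - 3 / (3 / 2 + c)"
  have "0 < \<epsilon>" using c by (simp add: \<epsilon>_def field_simps)
  moreover have "ln (real (card S)) \<le> ln M + (2 - \<epsilon>) * ln (real n)"
    if fin: "finite S" and ne: "S \<noteq> {}" and cmp: "comparable S X Y Z"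
      and rng: "\<And>s. s \<in> S \<Longrightarrow> X s \<in> {1..int n} \<and> Y s \<in> {1..int n} \<and> Z s \<in> {1..int n}"
    for S :: "'s set" and X Y Z n
  proof -
    have le: "ent S V \<le> ln (real n)" if "\<And>s. s \<in> S \<Longrightarrow> V s \<in> {1..int n}" for V
    proof (rule ent_le_ln_card[OF fin ne])
      have "card (V ` S) \<le> card {1..int n}" using that by (intro card_mono) auto
      then show "card (V ` S) \<le> n" by simp
    qed
    have "(3 / 2 + c) * (ln (real (card S)) - ln M) \<le> ent S X + ent S Y + ent S Z"
      by (rule sum_ent_ge[OF c M gain fin ne cmp])
    also have "\<dots> \<le> 3 * ln (real n)" using le[of X] le[of Y] le[of Z] rng by auto
    finally have "ln (real (card S)) - ln M \<le> 3 * ln (real n) / (3 / 2 + c)"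
      using c by (simp add: pos_le_divide_eq mult.commute)
    then show ?thesis by (simp add: \<epsilon>_def)
  qed
  ultimately show ?thesis using that M by blast
qed

theorem theorem1p13:
  shows "\<exists>\<epsilon>::real. \<epsilon> > 0 \<and>
    (\<forall>n::nat. n > 0 \<longrightarrow>
      (\<forall>as :: (int ^ 3) list.
         two_increasing as \<and> (\<forall>a \<in> set as. \<forall>i. a $ i \<in> {1..int n}) \<longrightarrow>
         real (length as) \<le> real n powr (2 - \<epsilon>)))"
proof -
  obtain \<delta> M :: real where \<delta>: "0 < \<delta>" and M: "1 \<le> M"
    and bound: "\<And>(S :: (int ^ 3) set) X Y Z n. finite S \<Longrightarrow> S \<noteq> {} \<Longrightarrow> comparable S X Y Z \<Longrightarrow>
       (\<And>s. s \<in> S \<Longrightarrow> X s \<in> {1..int n} \<and> Y s \<in> {1..int n} \<and> Z s \<in> {1..int n}) \<Longrightarrow>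
       ln (real (card S)) \<le> ln M + (2 - \<delta>) * ln (real n)"
    using comparable_card_bound by blast
  \<comment> \<open>From \<open>m\<close> on, half of \<open>\<delta>\<close> absorbs the constant
    \<open>M\<close>.\<close>
  obtain m :: nat where m: "exp (2 * ln M / \<delta>) \<le> real m" using real_arch_simple by blast
  have m1: "1 \<le> real m" using m M \<delta> by (smt (verit) one_le_exp_iff divide_nonneg_pos ln_ge_zero)
  \<comment> \<open>The second bound serves \<open>2 \<le> n < m\<close>, where
    \<open>card S \<le> n\<^sup>2 - 1\<close> is used: it gives
    \<open>\<epsilon> * ln n \<le> m / m ^ 3 \<le> 1 / n\<^sup>2\<close>.\<close>
  define \<epsilon> where "\<epsilon> = min (\<delta> / 2) (1 / real m ^ 3)"
  have \<epsilon>: "0 < \<epsilon>" "\<epsilon> \<le> \<delta> / 2" "\<epsilon> \<le> 1 / real m ^ 3" using \<delta> m1 by (auto simp: \<epsilon>_def)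
  show ?thesis
  proof (intro exI[of _ \<epsilon>] conjI allI impI \<epsilon>(1), elim conjE)
    fix n :: nat and as :: "(int ^ 3) list"
    assume n0: "n > 0" and inc: "two_increasing as" and rng: "\<forall>a\<in>set as. \<forall>i. a $ i \<in> {1..int n}"
    define S where "S = set as"
    have fin: "finite S" by (simp add: S_def)
    have cmp: "comparable S (\<lambda>a. a $ 1) (\<lambda>a. a $ 2) (\<lambda>a. a $ 3)"
      and len: "length as = card S"
      using two_increasing_distinct_comparable[OF inc] distinct_card[of as] by (auto simp: S_def)
    have rng': "s $ 1 \<in> {1..int n} \<and> s $ 2 \<in> {1..int n} \<and> s $ 3 \<in> {1..int n}" if "s \<in> S" for s
      using rng that by (auto simp: S_def)
    have ln0: "0 \<le> ln (real n)" using n0 by simp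
    show "real (length as) \<le> real n powr (2 - \<epsilon>)"
    proof (cases "S = {}")
      case True
      then show ?thesis by (simp add: len)
    next
      case ne: False
      then have cpos: "real (card S) > 0" using fin by (simp add: card_gt_0_iff)
      have "ln (real (card S)) \<le> (2 - \<epsilon>) * ln (real n)"
      proof (cases "m \<le> n")
        case True
        have "2 * ln M / \<delta> \<le> ln (real n)"
          using m m1 True by (smt (verit) ln_exp ln_mono exp_gt_zero of_nat_mono)
        then have "ln M \<le> \<delta> / 2 * ln (real n)" using \<delta> by (simp add: field_simps)
        moreover have "ln (real (card S)) \<le> ln M + (2 - \<delta>) * ln (real n)"
          by (rule bound[OF fin ne cmp rng'])
        ultimately have "ln (real (card S)) \<le> (2 - \<delta> / 2) * ln (real n)"
          by (simp add: algebra_simps)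
        also have "\<dots> \<le> (2 - \<epsilon>) * ln (real n)" using \<epsilon> ln0 by (intro mult_right_mono) auto
        finally show ?thesis .
      next
        case False
        show ?thesis
        proof (cases "n = 1")
          case True
          \<comment> \<open>Here \<open>ln n = 0\<close>, so \<open>S\<close> may have only one
            point.\<close>
          have "s = t" if "s \<in> S" "t \<in> S" for s t
            using that comparable_inj[OF cmp, of s t] rng'[of s] rng'[of t] True by auto
          then have "card S \<le> 1" using card_le_Suc0_iff_eq[OF fin] by simp
          then show ?thesis using cpos True by simp
        next
          case False
          then have n2: "2 \<le> n" using n0 by simp
          then have "(2::real)\<^sup>2 \<le> (real n)\<^sup>2" by (intro power_mono) auto
          then have sq: "1 < (real n)\<^sup>2" "(real n)\<^sup>2 \<noteq> 1" by simp_all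
          have "card S < n\<^sup>2" by (rule comparable_card_less_square[OF fin cmp n2 rng'])
          then have "real (card S) \<le> (real n)\<^sup>2 - 1" using n2
            by (metis Suc_leI of_nat_Suc of_nat_le_iff of_nat_power le_diff_eq add.commute)
          also have "\<dots> = (real n)\<^sup>2 * (1 - 1 / (real n)\<^sup>2)" using n2 by (simp add: field_simps)
          finally have "ln (real (card S)) \<le> ln ((real n)\<^sup>2 * (1 - 1 / (real n)\<^sup>2))"
            using cpos by (intro ln_mono) auto
          also have "\<dots> = 2 * ln (real n) + ln (1 - 1 / (real n)\<^sup>2)"
            using n2 sq(2) by (subst ln_mult) (auto simp: ln_realpow)
          also have "ln (1 - 1 / (real n)\<^sup>2) \<le> (1 - 1 / (real n)\<^sup>2) - 1"
          proof (rule ln_le_minus_one)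
            have "1 / (real n)\<^sup>2 < 1" using sq(1) by (subst divide_less_eq_1_pos) linarith+
            then show "0 < 1 - 1 / (real n)\<^sup>2" by linarith
          qed
          also have "\<dots> \<le> - (\<epsilon> * ln (real n))"
          proof -
            have nm: "real n \<le> real m" using \<open>\<not> m \<le> n\<close> by simp
            have "\<epsilon> * ln (real n) \<le> 1 / real m ^ 3 * real m"
              using \<epsilon> nm n0 ln_le_minus_one[of "real n"] ln0 by (intro mult_mono) auto
            also have "\<dots> = 1 / (real m)\<^sup>2" using m1 by (simp add: power2_eq_square power3_eq_cube)
            also have "\<dots> \<le> 1 / (real n)\<^sup>2" using nm n0 by (intro divide_left_mono power_mono) auto
            finally show ?thesis by simp
          qed
          finally show ?thesis by (simp add: algebra_simps)
        qed
      qed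
      then have "exp (ln (real (card S))) \<le> exp ((2 - \<epsilon>) * ln (real n))" by simp
      then show ?thesis using cpos n0 by (simp add: len powr_def)
    qed
  qed
qed

end
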